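(* Let $\Omega \subset \mathbb{R}^n$ be bounded, open, and connected, let $Q=Q(x)$ be an $n\times n$ positive semi-definite, self-adjoint, measurable matrix function on $\Omega$, and let $v$ be a non-negative measurable function on $\Omega$. Assume that: (i) $v \in L^1(\Omega)$; (ii) there is a constant $k$ such that $|Q(x)|_{\mathrm{op}} = \sup\{|Q(x)\xi| : \xi\in\mathbb{R}^n, |\xi|=1\} \leq k\,v(x)$ for almost every $x\in\Omega$; (iii) there exist $\sigma>1$ and a constant $C_0$ such that for all $\psi\in \mathrm{Lip}_0(\Omega)$, \[ \left(\int_\Omega |\psi(x)|^{2\sigma} v(x)\,dx\right)^{\frac{1}{2\sigma}} \leq C_0\left(\int_\Omega |Q^{\frac12}(x)\nabla\psi(x)|^2\,dx\right)^{\frac12}. \] Let $\sigma' = \frac{\sigma}{\sigma-1}$, let $q>\sigma'$, and let $A(t) = t^{\sigma'}\log(e+t)^q$ for $t \ge 0$. Then there exists a constant $C$, independent of $u$ and $f$, such that for every $f\in L^A(v;\Omega)$ and every non-negative weak solution $\mathbf{u} = (u,\nabla u)\in QH^1_0(v;\Omega)$ of the Dirichlet problem \[ -\operatorname{Div}(Q\nabla u) = v f \ \text{ in } \Omega,\qquad u = 0 \ \text{ on } \partial\Omega, \] we have \[ \|u\|_{L^\infty(v;\Omega)} \leq C\|f\|_{L^A(v;\Omega)}. \]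
   Context: $\mathrm{Lip}_0(\Omega)$ denotes the Lipschitz functions with compact support in $\Omega$. $Q^{1/2}=\sqrt{Q}$ is the positive semi-definite square root of $Q$. For a Young function $A:[0,\infty)\to[0,\infty)$ (increasing, convex, $A(0)=0$, $A(t)/t\to\infty$ as $t\to\infty$), the Orlicz space $L^A(v;\Omega)$ with respect to the measure $v\,dx$ consists of all measurable functions $f$ on $\Omega$ such that \[ \|f\|_{L^A(v;\Omega)} = \inf\left\{\mu>0 : \int_\Omega A\left(\frac{|f(x)|}{\mu}\right)v(x)\,dx\leq 1\right\}<\infty. \] $L^2(v;\Omega)$ and $L^\infty(v;\Omega)$ are the usual Lebesgue spaces on $\Omega$ with respect to the measure $v\,dx$; in particular $\|u\|_{L^\infty(v;\Omega)}$ is the essential supremum of $|u|$ with respect to $v\,dx$. $L^2_Q(\Omega)$ is the Banach space of (equivalence classes of) measurable vector-valued functions $\mathbf{g}:\Omega\to\mathbb{R}^n$ with norm $\|\mathbf{g}\|_{L^2_Q(\Omega)} = \left(\int_\Omega |\sqrt{Q(x)}\,\mathbf{g}(x)|^2\,dx\right)^{1/2}<\infty$. The degenerate Sobolev space $QH^1_0(v;\Omega)$ is the closure (completion) of $\mathrm{Lip}_0(\Omega)$ with respect to the norm \[ \|\psi\|_{QH^1_0(v;\Omega)} = \|\psi\|_{L^2(v;\Omega)} + \|\nabla\psi\|_{L^2_Q(\Omega)}. \] Its elements are identified with pairs $(u,\mathbf{g})\in L^2(v;\Omega)\times L^2_Q(\Omega)$ for which there is a sequence $\{\phi_k\}\subset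 \mathrm{Lip}_0(\Omega)$ with $\phi_k\to u$ in $L^2(v;\Omega)$ and $\nabla\phi_k\to\mathbf{g}$ in $L^2_Q(\Omega)$. One writes $\nabla u = \mathbf{g}$; note that $\nabla u$ is part of the data of the pair and need not be a weak derivative of $u$ in the classical sense. A weak solution of the Dirichlet problem is a pair $\mathbf{u}=(u,\nabla u)\in QH^1_0(v;\Omega)$ such that \[ \int_\Omega \nabla\psi(x)\cdot Q(x)\nabla u(x)\,dx = \int_\Omega f(x)\psi(x)v(x)\,dx \] for every $\psi\in\mathrm{Lip}_0(\Omega)$. It is non-negative if $u\geq 0$ $v\,dx$-almost everywhere in $\Omega$. *)

theory Defs
  imports "HOL-Probability.Probability" "HOL-Probability.Essential_Supremum"
begin

definition pos_semidef :: "real ^ 'n ^ 'n \<Rightarrow> bool" where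
  "pos_semidef M \<longleftrightarrow> transpose M = M \<and> (\<forall>\<xi>. 0 \<le> \<xi> \<bullet> (M *v \<xi>))"

definition mat_sqrt :: "real ^ 'n ^ 'n \<Rightarrow> real ^ 'n ^ 'n" where
  "mat_sqrt M = (THE S. pos_semidef S \<and> S ** S = M)"

(* By Rademacher's theorem the value 0 at points of non-differentiability is
   immaterial for Lipschitz f. *)
definition gradient :: "('a::euclidean_space \<Rightarrow> real) \<Rightarrow> 'a \<Rightarrow> 'a" where
  "gradient f x = (if \<exists>D. GDERIV f x :> D then (THE D. GDERIV f x :> D) else 0)"

(* Members are extended by zero to the whole space, which preserves the Lipschitz
   property because the support is a compact subset of \<Omega>. *)
definition Lip0 :: "'a::euclidean_space set \<Rightarrow> ('a \<Rightarrow> real) set" where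
  "Lip0 \<Omega> = {\<psi>. (\<exists>L. L-lipschitz_on UNIV \<psi>) \<and>
      compact (closure {x. \<psi> x \<noteq> 0}) \<and> closure {x. \<psi> x \<noteq> 0} \<subseteq> \<Omega>}"

(* The measure v dx on \<Omega>. *)
definition wmeasure :: "('a::euclidean_space \<Rightarrow> real) \<Rightarrow> 'a set \<Rightarrow> 'a measure" where
  "wmeasure v \<Omega> = density (lebesgue_on \<Omega>) (\<lambda>x. ennreal (v x))"

(* The function spaces below consist of functions rather than of classes modulo
   almost everywhere equality. *)

definition L2 :: "('a::euclidean_space \<Rightarrow> real) \<Rightarrow> 'a set \<Rightarrow> ('a \<Rightarrow> real) set" where
  "L2 v \<Omega> = {u \<in> borel_measurable (lebesgue_on \<Omega>). integrable (wmeasure v \<Omega>) (\<lambda>x. (u x)\<^sup>2)}"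

definition L2_norm :: "('a::euclidean_space \<Rightarrow> real) \<Rightarrow> 'a set \<Rightarrow> ('a \<Rightarrow> real) \<Rightarrow> real" where
  "L2_norm v \<Omega> u = sqrt (LINT x|wmeasure v \<Omega>. (u x)\<^sup>2)"

definition L2Q :: "(real ^ 'n \<Rightarrow> real ^ 'n ^ 'n) \<Rightarrow> (real ^ 'n) set \<Rightarrow> (real ^ 'n \<Rightarrow> real ^ 'n) set" where
  "L2Q Q \<Omega> = {g \<in> borel_measurable (lebesgue_on \<Omega>).
      integrable (lebesgue_on \<Omega>) (\<lambda>x. (norm (mat_sqrt (Q x) *v g x))\<^sup>2)}"

definition L2Q_norm ::
    "(real ^ 'n \<Rightarrow> real ^ 'n ^ 'n) \<Rightarrow> (real ^ 'n) set \<Rightarrow> (real ^ 'n \<Rightarrow> real ^ 'n) \<Rightarrow> real" where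
  "L2Q_norm Q \<Omega> g = sqrt (LINT x|lebesgue_on \<Omega>. (norm (mat_sqrt (Q x) *v g x))\<^sup>2)"

(* L2_norm and L2Q_norm are only meaningful on L2 and L2Q.  Membership of the
   approximants is automatic when v is integrable and |Q| is bounded by a multiple of v. *)
definition QH10 :: "(real ^ 'n \<Rightarrow> real ^ 'n ^ 'n) \<Rightarrow> (real ^ 'n \<Rightarrow> real) \<Rightarrow> (real ^ 'n) set
    \<Rightarrow> ((real ^ 'n \<Rightarrow> real) \<times> (real ^ 'n \<Rightarrow> real ^ 'n)) set" where
  "QH10 Q v \<Omega> = {(u, g). u \<in> L2 v \<Omega> \<and> g \<in> L2Q Q \<Omega> \<and>
      (\<exists>\<phi> :: nat \<Rightarrow> real ^ 'n \<Rightarrow> real.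
        (\<forall>k. \<phi> k \<in> Lip0 \<Omega> \<and> \<phi> k \<in> L2 v \<Omega> \<and> gradient (\<phi> k) \<in> L2Q Q \<Omega>) \<and>
        (\<lambda>k. L2_norm v \<Omega> (\<lambda>x. \<phi> k x - u x)) \<longlonglongrightarrow> 0 \<and>
        (\<lambda>k. L2Q_norm Q \<Omega> (\<lambda>x. gradient (\<phi> k) x - g x)) \<longlonglongrightarrow> 0)}"

(* The infimum of the empty set is top. *)
definition orlicz_norm ::
    "(real \<Rightarrow> real) \<Rightarrow> ('a::euclidean_space \<Rightarrow> real) \<Rightarrow> 'a set \<Rightarrow> ('a \<Rightarrow> real) \<Rightarrow> ennreal" where
  "orlicz_norm A v \<Omega> f =
    (INF \<mu> \<in> {\<mu>::real. 0 < \<mu> \<and> (\<integral>\<^sup>+x. ennreal (A (\<bar>f x\<bar> / \<mu>) * v x) \<partial>lebesgue_on \<Omega>) \<le> 1}.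
      ennreal \<mu>)"

definition orlicz_space ::
    "(real \<Rightarrow> real) \<Rightarrow> ('a::euclidean_space \<Rightarrow> real) \<Rightarrow> 'a set \<Rightarrow> ('a \<Rightarrow> real) set" where
  "orlicz_space A v \<Omega> = {f \<in> borel_measurable (lebesgue_on \<Omega>). orlicz_norm A v \<Omega> f < \<infinity>}"

definition Linf_norm :: "('a::euclidean_space \<Rightarrow> real) \<Rightarrow> 'a set \<Rightarrow> ('a \<Rightarrow> real) \<Rightarrow> ennreal" where
  "Linf_norm v \<Omega> u = esssup (wmeasure v \<Omega>) (\<lambda>x. ennreal \<bar>u x\<bar>)"

(* Weak solutions (u, g) of -Div (Q \<nabla>u) = v f in \<Omega>, u = 0 on the boundary; g plays the
   role of \<nabla>u and is part of the data. *)
definition weak_solution ::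
    "(real ^ 'n \<Rightarrow> real ^ 'n ^ 'n) \<Rightarrow> (real ^ 'n \<Rightarrow> real) \<Rightarrow> (real ^ 'n) set \<Rightarrow> (real ^ 'n \<Rightarrow> real)
      \<Rightarrow> (real ^ 'n \<Rightarrow> real) \<times> (real ^ 'n \<Rightarrow> real ^ 'n) \<Rightarrow> bool" where
  "weak_solution Q v \<Omega> f = (\<lambda>(u, g). (u, g) \<in> QH10 Q v \<Omega> \<and>
      (\<forall>\<psi> \<in> Lip0 \<Omega>.
        (LINT x|lebesgue_on \<Omega>. gradient \<psi> x \<bullet> (Q x *v g x)) =
        (LINT x|lebesgue_on \<Omega>. f x * \<psi> x * v x)))"

end

theory Submission
  imports Defs "HOL-Real_Asymp.Real_Asymp"
begin

text \<open>
  Write \<open>dN = v dx\<close>, \<open>\<theta> = 1/(2\<sigma>)\<close> and \<open>p = 2\<sigma>/(2\<sigma> - 1)\<close>, the exponent conjugate to \<open>2\<sigma>\<close>. The theorem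
  is proved by De Giorgi's method: the \<open>N\<close>-measure of the super-level sets \<open>{u \<ge> r}\<close> is shown to
  decay geometrically along a sequence of levels that stays bounded.

  The energy part is the inequality
  \<open>(s - r) N{u \<ge> s}\<^sup>\<theta> \<le> C\<^sub>0\<^sup>2 \<parallel>f\<parallel>\<close> for \<open>0 \<le> r < s\<close>, where the norm of \<open>f\<close> is that of \<open>L\<^sup>p\<close> with
  respect to \<open>N\<close> over \<open>{u \<ge> r}\<close> (\<open>level_gap_solution\<close>). Formally it comes from testing the
  equation with \<open>\<psi> = max 0 (u - r)\<close>: then the energy of \<open>\<psi>\<close> equals the integral of \<open>f \<psi>\<close>, the
  Sobolev inequality bounds the \<open>L\<close>-norm of \<open>\<psi>\<close> with exponent \<open>2\<sigma>\<close> by that energy, Hoelder's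
  inequality bounds the integral of \<open>f \<psi>\<close>, and Chebyshev's inequality turns the norm of \<open>\<psi>\<close> into
  the measure of \<open>{u \<ge> s}\<close>. Since \<open>\<nabla>u\<close> is only a limit of gradients and is not
  determined by \<open>u\<close> pointwise, the argument is carried out for the
  Lipschitz approximants \<open>\<phi>\<^sub>k\<close>, whose truncations are admissible test functions with gradient
  exactly \<open>\<nabla>\<phi>\<^sub>k\<close> on \<open>{\<phi>\<^sub>k > r}\<close> and \<open>0\<close> elsewhere (\<open>gradient_truncation\<close>). Replacing \<open>\<nabla>\<phi>\<^sub>k\<close> by \<open>\<nabla>u\<close> in
  one factor of the energy costs an error controlled by the distance of the two in \<open>L\<^sup>2\<^sub>Q\<close>
  (\<open>L2Q_truncated_energy_le\<close>), and the limit \<open>k \<rightarrow> \<infinity>\<close> is taken only in the resulting inequality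
  between super-level sets, along an almost everywhere convergent subsequence.

  The Orlicz part exploits the logarithm in \<open>A(t) = t\<^sup>\<tau> ln(e + t)\<^sup>q\<close>, \<open>\<tau> = \<sigma>'\<close>. If \<open>f\<close> is normalised
  and \<open>N(E) \<le> V e\<^bsup>-j\<^esup>\<close>, the \<open>L\<^sup>p\<close>-norm of \<open>f\<close> over \<open>E\<close> is at most a constant times
  \<open>e\<^bsup>-j\<theta>\<^esup> (j + 1)\<^bsup>-q/\<tau>\<^esup>\<close> (\<open>integral_powr_le_on_small_set\<close>). The factor \<open>e\<^bsup>-j\<theta>\<^esup>\<close> is exactly what the power
  \<open>\<theta>\<close> of the measure on the left of the energy inequality absorbs, as \<open>1/p - 1/\<tau> = \<theta>\<close>, so that a
  level gap of size a constant times \<open>(j + 1)\<^bsup>-q/\<tau>\<^esup>\<close> suffices to pass from measure \<open>V e\<^bsup>-j\<^esup>\<close> to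
  \<open>V e\<^bsup>-(j+1)\<^esup>\<close>. Because \<open>q > \<tau>\<close>, these gaps are summable, and \<open>u\<close> does not exceed their sum almost
  everywhere (\<open>AE_le_by_level_set_decay\<close>).

  Throughout, the norm \<open>|\<surd>Q g|\<^sup>2\<close> is handled as the quadratic form \<open>g \<bullet> Q g\<close>, which is visibly
  measurable; this rests on existence and uniqueness of the positive semi-definite square root,
  obtained from an orthonormal eigenbasis.
\<close>

section \<open>Square roots of positive semi-definite matrices\<close>

text \<open>A maximiser \<open>b\<close> of the Rayleigh quotient over \<open>S\<close> is an eigenvector: with \<open>c\<close> the maximum and
  \<open>w = f b - c b \<in> S\<close>, moving from \<open>b\<close> in direction \<open>w\<close> would increase the quotient to first order
  unless \<open>w = 0\<close>.\<close>
lemma symmetric_eigenvector_in_subspace: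
  fixes f :: "'a::euclidean_space \<Rightarrow> 'a"
  assumes f: "linear f" and sym: "\<And>x y. f x \<bullet> y = x \<bullet> f y"
    and S: "subspace S" "f ` S \<subseteq> S" "S \<noteq> {0}"
  obtains b c where "b \<in> S" "norm b = 1" "f b = c *\<^sub>R b"
proof -
  let ?K = "S \<inter> sphere 0 1"
  have "closed S" using S(1) by (rule closed_subspace)
  then have K: "compact ?K" by (intro closed_Int_compact) auto
  obtain z where z: "z \<in> S" "z \<noteq> 0" using S subspace_0 by blast
  have "(1 / norm z) *\<^sub>R z \<in> ?K" using z S(1) by (auto simp: subspace_scale)
  then have ne: "?K \<noteq> {}" by blast
  have "continuous_on ?K (\<lambda>x. x \<bullet> f x)"
    by (intro continuous_intros linear_continuous_on linear_conv_bounded_linear[THEN iffD1] f)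
  from continuous_attains_sup[OF K ne this]
  obtain b where b: "b \<in> S" "norm b = 1" and max: "\<And>y. y \<in> ?K \<Longrightarrow> y \<bullet> f y \<le> b \<bullet> f b"
    by auto
  define c where "c = b \<bullet> f b"
  have le: "y \<bullet> f y \<le> c * (y \<bullet> y)" if "y \<in> S" for y
  proof (cases "y = 0")
    case False
    have "(1 / norm y) *\<^sub>R y \<in> ?K" using that False S(1) by (auto simp: subspace_scale)
    from max[OF this] have "(y \<bullet> f y) / (norm y)\<^sup>2 \<le> c"
      by (simp add: linear_scale[OF f] c_def power2_eq_square)
    then show ?thesis using False by (simp add: field_simps dot_square_norm)
  qed (simp add: linear_0[OF f])
  define w where "w = f b - c *\<^sub>R b"
  have wS: "w \<in> S" unfolding w_def using b S by (auto intro!: subspace_diff subspace_scale)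
  have bb: "b \<bullet> b = 1" using b by (simp add: dot_square_norm)
  have bw: "b \<bullet> w = 0" by (simp add: w_def inner_diff_right bb c_def)
  have fw: "f b \<bullet> w = w \<bullet> w"
    using bw by (simp add: w_def inner_diff_left)
  have quad: "2 * t * (w \<bullet> w) + t\<^sup>2 * (w \<bullet> f w - c * (w \<bullet> w)) \<le> 0" for t :: real
  proof -
    have "b + t *\<^sub>R w \<in> S" using b wS S(1) by (auto intro!: subspace_add subspace_scale)
    from le[OF this] show ?thesis
      by (simp add: linear_add[OF f] linear_scale[OF f] inner_add_left inner_add_right
          bb bw fw inner_commute[of w b] inner_commute[of w "f b"] sym[of b w, symmetric]
          c_def[symmetric] power2_eq_square algebra_simps)
  qed
  have "w \<bullet> w = 0"
  proof (rule ccontr)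
    assume nz: "w \<bullet> w \<noteq> 0"
    then have pos: "w \<bullet> w > 0" by (simp add: order_less_le)
    let ?d = "w \<bullet> f w - c * (w \<bullet> w)"
    \<comment> \<open>A step so small that the quadratic term cannot cancel the positive linear one.\<close>
    define t where "t = (w \<bullet> w) / (\<bar>?d\<bar> + 1)"
    have t: "t > 0" unfolding t_def using pos by (intro divide_pos_pos) auto
    have "t * \<bar>?d\<bar> \<le> w \<bullet> w" unfolding t_def using pos by (simp add: field_simps)
    moreover have "t * - ?d \<le> t * \<bar>?d\<bar>" using t by (intro mult_left_mono) auto
    ultimately have "t * - ?d \<le> w \<bullet> w" by linarith
    then have "2 * (w \<bullet> w) + t * ?d > 0" using pos by (simp only: mult_minus_right)
    then have "t * (2 * (w \<bullet> w) + t * ?d) > 0" using t by (intro mult_pos_pos)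
    with quad[of t] show False by (simp add: power2_eq_square algebra_simps)
  qed
  then have "f b = c *\<^sub>R b" by (simp add: w_def)
  with b that show ?thesis by blast
qed

text \<open>The orthogonal complement of an eigenvector within an invariant subspace is again invariant,
  because \<open>f\<close> is symmetric; this gives an induction on the dimension.\<close>
lemma symmetric_orthonormal_eigenbasis:
  fixes f :: "'a::euclidean_space \<Rightarrow> 'a"
  assumes f: "linear f" and sym: "\<And>x y. f x \<bullet> y = x \<bullet> f y"
    and S: "subspace S" "f ` S \<subseteq> S"
  shows "\<exists>B c. finite B \<and> pairwise orthogonal B \<and> span B = S \<and>
    (\<forall>b\<in>B. norm b = 1 \<and> f b = c b *\<^sub>R b)"
  using S
proof (induction "dim S" arbitrary: S rule: less_induct)
  case less
  show ?case
  proof (cases "S = {0}")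
    case True
    then show ?thesis by (intro exI[of _ "{}"]) auto
  next
    case False
    obtain b c0 where b: "b \<in> S" "norm b = 1" "f b = c0 *\<^sub>R b"
      using symmetric_eigenvector_in_subspace[OF f sym less.prems False] by blast
    have bb: "b \<bullet> b = 1" using b by (simp add: dot_square_norm)
    define S' where "S' = S \<inter> {x. b \<bullet> x = 0}"
    have S': "subspace S'" unfolding S'_def
      using less.prems(1) subspace_hyperplane[of b] by (rule subspace_inter)
    have inv: "f ` S' \<subseteq> S'"
      using less.prems(2) by (auto simp: S'_def sym[symmetric] b)
    have "b \<notin> S'" using bb by (simp add: S'_def)
    then have "S' \<subset> S" using b(1) unfolding S'_def by blast
    then have "span S' \<subset> span S"
      using S' less.prems(1) by (simp add: span_eq_iff[THEN iffD2])
    then have "dim S' < dim S" by (rule dim_psubset)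
    from less.hyps[OF this S' inv] obtain B c where B: "finite B" "pairwise orthogonal B"
      "span B = S'" "\<forall>b\<in>B. norm b = 1 \<and> f b = c b *\<^sub>R b" by blast
    have BS': "B \<subseteq> S'" using B(3) span_superset by blast
    have "b \<notin> B" using BS' \<open>b \<notin> S'\<close> by blast
    have "span (insert b B) = S"
    proof
      show "span (insert b B) \<subseteq> S"
        using BS' b less.prems(1) by (intro span_minimal) (auto simp: S'_def)
      show "S \<subseteq> span (insert b B)"
      proof
        fix x assume "x \<in> S"
        then have "x - (b \<bullet> x) *\<^sub>R b \<in> S'"
          using b less.prems(1) bb
          by (auto simp: S'_def inner_diff_right intro!: subspace_diff subspace_scale)
        then show "x \<in> span (insert b B)"
          unfolding span_insert using B(3) by blast
      qed
    qed
    moreover have "pairwise orthogonal (insert b B)"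
      using B(2) BS' by (auto simp: pairwise_insert orthogonal_def S'_def inner_commute)
    moreover have "\<forall>a\<in>insert b B. norm a = 1 \<and> f a = (c(b := c0)) a *\<^sub>R a"
      using B(4) b \<open>b \<notin> B\<close> by auto
    ultimately show ?thesis using B(1) by (intro exI[of _ "insert b B"] exI[of _ "c(b:=c0)"]) auto
  qed
qed
lemma pos_semidef_symmetric: "pos_semidef M \<Longrightarrow> (M *v x) \<bullet> y = x \<bullet> (M *v y)"
  unfolding pos_semidef_def by (metis dot_lmul_matrix transpose_matrix_vector vector_transpose_matrix)

lemma pos_semidef_eigenbasis:
  fixes M :: "real ^ 'n ^ 'n"
  assumes "pos_semidef M"
  shows "\<exists>B c. finite B \<and> pairwise orthogonal B \<and> span B = (UNIV :: (real ^ 'n) set) \<and>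
    (\<forall>b\<in>B. norm b = 1 \<and> M *v b = c b *\<^sub>R b \<and> 0 \<le> c b)"
proof -
  obtain B c where B: "finite B" "pairwise orthogonal B" "span B = (UNIV :: (real ^ 'n) set)"
    and c: "\<forall>b\<in>B. norm b = 1 \<and> M *v b = c b *\<^sub>R b"
    using symmetric_orthonormal_eigenbasis[OF matrix_vector_mul_linear[of M]
        pos_semidef_symmetric[OF assms] subspace_UNIV subset_UNIV] by blast
  have "0 \<le> c b" if "b \<in> B" for b
  proof -
    have "0 \<le> b \<bullet> (M *v b)" using assms by (auto simp: pos_semidef_def)
    then show ?thesis using c that by (simp add: dot_square_norm)
  qed
  with B c show ?thesis by blast
qed

lemma pos_semidef_sqrt_exists:
  fixes M :: "real ^ 'n ^ 'n"
  assumes "pos_semidef M"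
  shows "\<exists>S. pos_semidef S \<and> S ** S = M"
proof -
  obtain B c where B: "finite B" "pairwise orthogonal B" "span B = (UNIV :: (real ^ 'n) set)"
    and c: "\<And>b. b \<in> B \<Longrightarrow> norm b = 1" "\<And>b. b \<in> B \<Longrightarrow> M *v b = c b *\<^sub>R b"
    and c0: "\<And>b. b \<in> B \<Longrightarrow> 0 \<le> c b"
    using pos_semidef_eigenbasis[OF assms] by blast
  define g where "g x = (\<Sum>b\<in>B. (sqrt (c b) * (b \<bullet> x)) *\<^sub>R b)" for x
  have lin: "linear g"
    by (rule linearI) (simp_all add: g_def inner_add_right distrib_left scaleR_add_left
        sum.distrib scaleR_sum_right ac_simps)
  have gsym: "g x \<bullet> y = x \<bullet> g y" for x y
    by (simp add: g_def inner_sum_left inner_sum_right inner_commute ac_simps)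
  have gpos: "0 \<le> x \<bullet> g x" for x
    using c0 by (simp add: g_def inner_sum_right inner_commute[of x] mult.assoc sum_nonneg)
  have gb: "g b = sqrt (c b) *\<^sub>R b" if "b \<in> B" for b
  proof -
    have "g b = (\<Sum>a\<in>B. if a = b then sqrt (c b) *\<^sub>R b else 0)"
      unfolding g_def using B(2) that c(1)
      by (intro sum.cong refl) (auto simp: pairwise_def orthogonal_def dot_square_norm)
    then show ?thesis using B(1) that by simp
  qed
  have "g (g x) = M *v x" for x
  proof (rule linear_eq_on[where B = B and f = "g \<circ> g" and g = "(*v) M", simplified comp_def])
    show "linear (\<lambda>x. g (g x))" using linear_compose[OF lin lin] by (simp add: comp_def)
    show "x \<in> span B" using B by simp
    show "g (g b) = M *v b" if "b \<in> B" for b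
      using that c0 by (simp add: gb linear_scale[OF lin] c(2))
  qed simp
  then have "matrix g ** matrix g = M"
    by (simp add: matrix_eq matrix_vector_mul_assoc[symmetric] matrix_works lin)
  moreover have "pos_semidef (matrix g)"
  proof -
    have "axis j 1 \<bullet> g (axis i 1) = axis i 1 \<bullet> g (axis j 1)" for i j
      by (metis gsym inner_commute)
    then have "transpose (matrix g) = matrix g"
      by (simp add: transpose_def matrix_def vec_eq_iff inner_axis')
    then show ?thesis using gpos by (simp add: pos_semidef_def matrix_works lin)
  qed
  ultimately show ?thesis by blast
qed

text \<open>On an eigenvector \<open>b\<close> of \<open>S\<close> with eigenvalue \<open>c\<close>, the vector \<open>w = T b - c b\<close> satisfies \<open>T w = - c w\<close>
  since \<open>T\<^sup>2 b = c\<^sup>2 b\<close>. As \<open>T\<close> is positive semi-definite, \<open>w = 0\<close> when \<open>c > 0\<close>; when \<open>c = 0\<close> one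
  has \<open>|T b|\<^sup>2 = b \<bullet> T\<^sup>2 b = 0\<close>.\<close>
lemma pos_semidef_sqrt_unique:
  fixes S T :: "real ^ 'n ^ 'n"
  assumes S: "pos_semidef S" and T: "pos_semidef T" and eq: "S ** S = T ** T"
  shows "S = T"
proof -
  obtain B c where B: "span B = (UNIV :: (real ^ 'n) set)"
    and c: "\<And>b. b \<in> B \<Longrightarrow> norm b = 1" "\<And>b. b \<in> B \<Longrightarrow> S *v b = c b *\<^sub>R b"
    and c0: "\<And>b. b \<in> B \<Longrightarrow> 0 \<le> c b"
    using pos_semidef_eigenbasis[OF S] by blast
  have "T *v b = S *v b" if b: "b \<in> B" for b
  proof -
    let ?w = "T *v b - c b *\<^sub>R b"
    have TT: "T *v (T *v b) = (c b * c b) *\<^sub>R b"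
      using arg_cong[OF eq, of "\<lambda>M. M *v b"] c[OF b]
      by (simp add: matrix_vector_mul_assoc[symmetric] matrix_vector_mult_scaleR)
    have Tw: "T *v ?w = - c b *\<^sub>R ?w"
      by (simp add: matrix_vector_mult_diff_distrib matrix_vector_mult_scaleR TT algebra_simps)
    have "0 \<le> ?w \<bullet> (T *v ?w)" using T by (auto simp: pos_semidef_def)
    then have *: "c b * (?w \<bullet> ?w) \<le> 0" by (simp add: Tw)
    have "?w = 0"
    proof (cases "c b = 0")
      case True
      have "(T *v b) \<bullet> (T *v b) = b \<bullet> (T *v (T *v b))" by (rule pos_semidef_symmetric[OF T])
      then show ?thesis using True TT by simp
    next
      case False
      then have "c b > 0" using c0[OF b] by simp
      with * have "?w \<bullet> ?w \<le> 0" by (simp add: mult_le_0_iff)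
      then show ?thesis by (metis inner_gt_zero_iff not_le)
    qed
    then show ?thesis using c[OF b] by simp
  qed
  then have "S *v x = T *v x" for x
    using linear_eq_on[OF matrix_vector_mul_linear[of S] matrix_vector_mul_linear[of T], of x B]
    by (simp add: B)
  then show ?thesis by (simp add: matrix_eq)
qed

lemma mat_sqrt:
  assumes "pos_semidef M"
  shows pos_semidef_mat_sqrt: "pos_semidef (mat_sqrt M)"
    and mat_sqrt_square: "mat_sqrt M ** mat_sqrt M = M"
proof -
  have "\<exists>!S. pos_semidef S \<and> S ** S = M"
    using pos_semidef_sqrt_exists[OF assms] pos_semidef_sqrt_unique by blast
  from theI'[OF this] show "pos_semidef (mat_sqrt M)" "mat_sqrt M ** mat_sqrt M = M"
    by (auto simp: mat_sqrt_def)
qed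

lemma inner_mat_sqrt:
  assumes "pos_semidef M"
  shows "(mat_sqrt M *v x) \<bullet> (mat_sqrt M *v y) = x \<bullet> (M *v y)"
  using pos_semidef_symmetric[OF pos_semidef_mat_sqrt[OF assms]] mat_sqrt_square[OF assms]
  by (simp add: matrix_vector_mul_assoc)

section \<open>Truncations of Lipschitz functions\<close>

lemma gradient_cong_local:
  assumes "open U" "x \<in> U" "\<And>y. y \<in> U \<Longrightarrow> f y = h y + c"
  shows "gradient f x = gradient h x"
proof -
  have "GDERIV f x :> D \<longleftrightarrow> GDERIV h x :> D" for D
  proof
    assume "GDERIV f x :> D"
    then have "((\<lambda>y. f y - c) has_derivative (\<lambda>h. inner h D)) (at x)"
      unfolding gderiv_def by (auto intro!: derivative_eq_intros)
    then show "GDERIV h x :> D"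
      unfolding gderiv_def by (rule has_derivative_transform_within_open[OF _ assms(1,2)]) (simp add: assms)
  next
    assume "GDERIV h x :> D"
    then have "((\<lambda>y. h y + c) has_derivative (\<lambda>h. inner h D)) (at x)"
      unfolding gderiv_def by (auto intro!: derivative_eq_intros)
    then show "GDERIV f x :> D"
      unfolding gderiv_def by (rule has_derivative_transform_within_open[OF _ assms(1,2)]) (simp add: assms)
  qed
  then have "gderiv f x = gderiv h x" by (intro ext)
  then show ?thesis by (simp add: gradient_def)
qed

text \<open>This covers points of non-differentiability too, because \<open>gradient\<close> takes the value \<open>0\<close> there.\<close>
lemma gradient_eq_0_at_minimum:
  assumes "\<And>y. f x \<le> f y"
  shows "gradient f x = 0"
proof -
  have "D = 0" if "GDERIV f x :> D" for D
  proof -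
    have "(\<lambda>h. inner h D) = (\<lambda>h. 0)"
      by (rule differential_zero_maxmin[of x UNIV f]) (use that assms in \<open>auto simp: gderiv_def\<close>)
    then have "inner D D = 0" by metis
    then show ?thesis by simp
  qed
  then have "(THE D. GDERIV f x :> D) = 0" if "\<exists>D. GDERIV f x :> D"
    using that by (metis the_equality)
  then show ?thesis by (auto simp: gradient_def)
qed

text \<open>The identity holds at every point, including the level set \<open>{\<phi> = r}\<close>: wherever \<open>\<phi> x \<le> r\<close>, the
  truncation attains its minimum \<open>0\<close>, so its gradient vanishes by the previous lemma.\<close>
lemma gradient_truncation:
  assumes "continuous_on UNIV \<phi>"
  shows "gradient (\<lambda>y. max 0 (\<phi> y - r)) x = (if r < \<phi> x then gradient \<phi> x else 0)"
proof (cases "r < \<phi> x")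
  case True
  have "open {y. r < \<phi> y}" using assms by (intro open_Collect_less) auto
  then show ?thesis
    using True gradient_cong_local[of "{y. r < \<phi> y}" x "\<lambda>y. max 0 (\<phi> y - r)" \<phi> "- r"] by simp
next
  case False
  then have "gradient (\<lambda>y. max 0 (\<phi> y - r)) x = 0"
    by (intro gradient_eq_0_at_minimum) simp
  with False show ?thesis by simp
qed

lemma Lip0_truncation:
  assumes \<phi>: "\<phi> \<in> Lip0 \<Omega>" and r: "0 \<le> r"
  shows "(\<lambda>y. max 0 (\<phi> y - r)) \<in> Lip0 \<Omega>"
proof -
  obtain L where L: "L-lipschitz_on UNIV \<phi>" using \<phi> by (auto simp: Lip0_def)
  have "L-lipschitz_on UNIV (\<lambda>y. max 0 (\<phi> y - r))"
  proof (rule lipschitz_onI)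
    fix x y
    have "dist (max 0 (\<phi> x - r)) (max 0 (\<phi> y - r)) \<le> dist (\<phi> x) (\<phi> y)"
      by (auto simp: dist_real_def max_def)
    also have "\<dots> \<le> L * dist x y" using L by (rule lipschitz_onD) auto
    finally show "dist (max 0 (\<phi> x - r)) (max 0 (\<phi> y - r)) \<le> L * dist x y" .
  qed (use L in \<open>rule lipschitz_on_nonneg\<close>)
  moreover have sub: "closure {y. max 0 (\<phi> y - r) \<noteq> 0} \<subseteq> closure {y. \<phi> y \<noteq> 0}"
    using r by (intro closure_mono) auto
  moreover have "compact (closure {y. max 0 (\<phi> y - r) \<noteq> 0})"
    using \<phi> sub by (metis (mono_tags, lifting) Lip0_def bounded_subset closure_subset
        compact_closure mem_Collect_eq order_trans bounded_closure)
  ultimately show ?thesis using \<phi> by (auto simp: Lip0_def)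
qed

lemma Lip0_continuous: "\<phi> \<in> Lip0 \<Omega> \<Longrightarrow> continuous_on UNIV \<phi>"
  by (auto simp: Lip0_def intro: lipschitz_on_continuous_on)

lemma Lip0_bounded:
  assumes "\<phi> \<in> Lip0 \<Omega>"
  obtains B where "\<And>x. \<bar>\<phi> x\<bar> \<le> B"
proof -
  let ?K = "closure {x. \<phi> x \<noteq> 0}"
  have "compact (\<phi> ` ?K)"
    using assms Lip0_continuous[OF assms]
    by (intro compact_continuous_image) (auto simp: Lip0_def intro: continuous_on_subset)
  then obtain B where B: "\<And>x. x \<in> ?K \<Longrightarrow> \<bar>\<phi> x\<bar> \<le> B"
    using compact_imp_bounded by (force simp: bounded_iff)
  have "\<bar>\<phi> x\<bar> \<le> max B 0" for x
    using B[of x] closure_subset[of "{x. \<phi> x \<noteq> 0}"] by (cases "\<phi> x = 0") auto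
  then show ?thesis using that by blast
qed

section \<open>Integral inequalities and limits\<close>

text \<open>Young's inequality, applied to \<open>f\<close> and \<open>g\<close> divided by their norms, and integrated.\<close>
lemma Holder_inequality:
  fixes f g :: "'a \<Rightarrow> real"
  assumes pq: "p > 1" "q > 1" "1 / p + 1 / q = 1"
    and [measurable]: "f \<in> borel_measurable M" "g \<in> borel_measurable M"
    and f: "integrable M (\<lambda>x. \<bar>f x\<bar> powr p)" and g: "integrable M (\<lambda>x. \<bar>g x\<bar> powr q)"
  shows integrable_mult_Holder: "integrable M (\<lambda>x. f x * g x)"
    and integral_mult_le_Holder: "(LINT x|M. \<bar>f x * g x\<bar>)
      \<le> (LINT x|M. \<bar>f x\<bar> powr p) powr (1 / p) * (LINT x|M. \<bar>g x\<bar> powr q) powr (1 / q)"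
proof -
  have young: "\<bar>f x * g x\<bar> \<le> \<bar>f x\<bar> powr p / p + \<bar>g x\<bar> powr q / q" for x
    using Youngs_inequality[OF pq, of "\<bar>f x\<bar>" "\<bar>g x\<bar>"] by (simp add: abs_mult)
  show int: "integrable M (\<lambda>x. f x * g x)"
  proof (rule Bochner_Integration.integrable_bound)
    show "integrable M (\<lambda>x. \<bar>f x\<bar> powr p / p + \<bar>g x\<bar> powr q / q)" using f g by simp
    show "AE x in M. norm (f x * g x) \<le> norm (\<bar>f x\<bar> powr p / p + \<bar>g x\<bar> powr q / q)"
      using order_trans[OF young abs_ge_self] by simp
  qed simp
  let ?F = "LINT x|M. \<bar>f x\<bar> powr p" and ?G = "LINT x|M. \<bar>g x\<bar> powr q"
  have nonneg: "?F \<ge> 0" "?G \<ge> 0" by simp_all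
  have zero: "(LINT x|M. \<bar>f x * g x\<bar>) = 0" if "?F = 0 \<or> ?G = 0"
  proof -
    have "AE x in M. f x * g x = 0"
    proof (cases "?F = 0")
      case True
      then have "AE x in M. \<bar>f x\<bar> powr p = 0"
        using integral_nonneg_eq_0_iff_AE[OF f] by simp
      then show ?thesis by eventually_elim simp
    next
      case False
      then have "AE x in M. \<bar>g x\<bar> powr q = 0"
        using integral_nonneg_eq_0_iff_AE[OF g] that by simp
      then show ?thesis by eventually_elim simp
    qed
    then have "(LINT x|M. \<bar>f x * g x\<bar>) = (LINT x|M. 0)"
      by (intro integral_cong_AE) auto
    then show ?thesis by simp
  qed
  show "(LINT x|M. \<bar>f x * g x\<bar>) \<le> ?F powr (1 / p) * ?G powr (1 / q)"
  proof (cases "?F = 0 \<or> ?G = 0")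
    case True
    then show ?thesis using zero by auto
  next
    case False
    define a b where "a = ?F powr (1 / p)" and "b = ?G powr (1 / q)"
    have ab: "a > 0" "b > 0" using False nonneg by (auto simp: a_def b_def)
    have apow: "a powr p = ?F" "b powr q = ?G"
      using pq nonneg by (auto simp: a_def b_def powr_powr)
    have "(LINT x|M. \<bar>f x * g x\<bar>) / (a * b) = (LINT x|M. \<bar>f x / a * (g x / b)\<bar>)"
      using ab by (simp add: abs_mult)
    also have "\<dots> \<le> (LINT x|M. (\<bar>f x\<bar> powr p / ?F) / p + (\<bar>g x\<bar> powr q / ?G) / q)"
    proof (rule integral_mono)
      show "integrable M (\<lambda>x. \<bar>f x / a * (g x / b)\<bar>)" using int by simp
      show "integrable M (\<lambda>x. \<bar>f x\<bar> powr p / ?F / p + \<bar>g x\<bar> powr q / ?G / q)" using f g by simp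
      show "\<bar>f x / a * (g x / b)\<bar> \<le> \<bar>f x\<bar> powr p / ?F / p + \<bar>g x\<bar> powr q / ?G / q" for x
        using Youngs_inequality[OF pq, of "\<bar>f x\<bar> / a" "\<bar>g x\<bar> / b"] ab
        by (simp add: abs_mult powr_divide apow)
    qed
    also have "\<dots> = 1 / p + 1 / q" using f g False by simp
    finally show ?thesis using ab pq by (simp add: a_def[symmetric] b_def[symmetric] field_simps)
  qed
qed

lemma integral_Cauchy_Schwarz:
  fixes a b :: "'a \<Rightarrow> real"
  assumes [measurable]: "a \<in> borel_measurable M" "b \<in> borel_measurable M"
    and a: "integrable M (\<lambda>x. (a x)\<^sup>2)" and b: "integrable M (\<lambda>x. (b x)\<^sup>2)"
  shows "integrable M (\<lambda>x. a x * b x)"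
    and "(LINT x|M. a x * b x) \<le> sqrt (LINT x|M. (a x)\<^sup>2) * sqrt (LINT x|M. (b x)\<^sup>2)"
proof -
  have sq: "\<bar>t\<bar> powr 2 = t\<^sup>2" for t :: real by (cases "t = 0") auto
  note H = Holder_inequality[of 2 2 a M b, unfolded sq]
  show int: "integrable M (\<lambda>x. a x * b x)" using a b by (intro H) auto
  have "(LINT x|M. a x * b x) \<le> (LINT x|M. \<bar>a x * b x\<bar>)"
    using int by (intro integral_mono) auto
  also have "\<dots> \<le> (LINT x|M. (a x)\<^sup>2) powr (1 / 2) * (LINT x|M. (b x)\<^sup>2) powr (1 / 2)"
    using a b by (intro H) auto
  finally show "(LINT x|M. a x * b x) \<le> sqrt (LINT x|M. (a x)\<^sup>2) * sqrt (LINT x|M. (b x)\<^sup>2)"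
    by (simp add: powr_half_sqrt)
qed

lemma integral_of_bool_eq_measure:
  assumes [measurable]: "Measurable.pred N P"
  shows "(LINT x|N. (if P x then 1 else 0 :: real)) = measure N {x \<in> space N. P x}"
proof -
  have "(LINT x|N. (if P x then 1 else 0 :: real)) = (LINT x|N. indicator {x \<in> space N. P x} x)"
    by (intro Bochner_Integration.integral_cong) auto
  then show ?thesis by simp
qed

text \<open>Used for predicates such as \<open>t < \<phi>\<^sub>k x\<close>. Almost everywhere convergence of \<open>\<phi>\<^sub>k\<close> to \<open>u\<close> decides
  such a predicate eventually only where \<open>u x \<noteq> t\<close>, so it has to be combined with the corresponding
  predicate for \<open>u\<close> in a way that settles the points with \<open>u x = t\<close>.\<close>
lemma tendsto_integral_if:
  fixes h :: "'a \<Rightarrow> real"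
  assumes h: "integrable N h"
    and [measurable]: "\<And>k. Measurable.pred N (P k)" "Measurable.pred N Q"
    and ev: "AE x in N. eventually (\<lambda>k. P k x = Q x) sequentially"
  shows "(\<lambda>k. LINT x|N. (if P k x then h x else 0)) \<longlonglongrightarrow> (LINT x|N. (if Q x then h x else 0))"
proof (rule integral_dominated_convergence[where w = "\<lambda>x. \<bar>h x\<bar>"])
  have [measurable]: "h \<in> borel_measurable N" using h by simp
  show "(\<lambda>x. if Q x then h x else 0) \<in> borel_measurable N" by simp
  show "(\<lambda>x. if P k x then h x else 0) \<in> borel_measurable N" for k by simp
  show "AE x in N. (\<lambda>k. if P k x then h x else 0) \<longlonglongrightarrow> (if Q x then h x else 0)"
    using ev by eventually_elim (auto intro!: tendsto_eventually elim: eventually_mono)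
qed (use h in auto)

section \<open>Smallness of integrals of Orlicz functions over small sets\<close>

text \<open>The height \<open>T = e\<^bsup>j/\<tau>\<^esup> (j + 1)\<^bsup>-q/\<tau>\<^esup>\<close> at which a function is split below still has a logarithm of
  order \<open>j\<close>: \<open>\<tau> ln T = j - q ln (j + 1)\<close>, and the concave term is at most \<open>(j + 1)/2\<close> plus a
  constant. The summand \<open>e\<close> takes care of the finitely many \<open>j\<close> for which this is not positive.\<close>
lemma ln_split_height_ge:
  fixes \<tau> q :: real
  assumes \<tau>: "1 \<le> \<tau>" and q: "0 < q"
  shows "\<exists>c>0. \<forall>j::nat. c * (real j + 1)
    \<le> ln (exp 1 + exp (real j / \<tau>) * (real j + 1) powr (- q / \<tau>))"
proof -
  define B where "B = 1 + q * \<bar>ln (2 * q)\<bar>"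
  have B: "B \<ge> 0" using q by (simp add: B_def)
  define c where "c = 1 / (2 * \<tau> * (1 + B))"
  have c: "c > 0" using \<tau> B by (simp add: c_def)
  have "c * (real j + 1) \<le> ln (exp 1 + exp (real j / \<tau>) * (real j + 1) powr (- q / \<tau>))" for j :: nat
  proof -
    define T where "T = exp (real j / \<tau>) * (real j + 1) powr (- q / \<tau>)"
    have T: "T > 0" by (simp add: T_def)
    \<comment> \<open>The tangent of the logarithm at \<open>2 q\<close> has slope \<open>1/(2 q)\<close>, which turns \<open>q ln (j + 1)\<close> into \<open>(j + 1)/2\<close>.\<close>
    have "ln ((real j + 1) / (2 * q)) \<le> (real j + 1) / (2 * q) - 1"
      using q by (intro ln_le_minus_one) simp
    then have "ln (real j + 1) \<le> (real j + 1) / (2 * q) - 1 + ln (2 * q)"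
      using q by (simp add: ln_div)
    then have "q * ln (real j + 1) \<le> q * ((real j + 1) / (2 * q) - 1 + ln (2 * q))"
      using q by (intro mult_left_mono) auto
    also have "\<dots> = (real j + 1) / 2 - q + q * ln (2 * q)" using q by (simp add: field_simps)
    also have "\<dots> \<le> (real j + 1) / 2 + q * \<bar>ln (2 * q)\<bar>"
      using q mult_left_mono[of "ln (2 * q)" "\<bar>ln (2 * q)\<bar>" q] by linarith
    finally have 1: "q * ln (real j + 1) \<le> (real j + 1) / 2 + (B - 1)" by (simp add: B_def)
    have "ln T = real j / \<tau> + (- q / \<tau>) * ln (real j + 1)"
      by (simp add: T_def ln_mult ln_powr)
    then have "\<tau> * ln T = real j - q * ln (real j + 1)"
      using \<tau> by (simp add: field_simps)
    with 1 have 2: "\<tau> * ln T \<ge> (real j + 1) / 2 - B" by (simp add: field_simps)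
    define L where "L = \<tau> * ln (exp 1 + T)"
    have "ln T \<le> ln (exp 1 + T)" using T by (subst ln_le_cancel_iff) (auto simp: add_pos_pos)
    then have L1: "L \<ge> (real j + 1) / 2 - B"
      unfolding L_def using 2 \<tau> mult_left_mono[of "ln T" "ln (exp 1 + T)" \<tau>] by linarith
    have "ln (exp 1) \<le> ln (exp 1 + T)" using T by (subst ln_le_cancel_iff) (auto simp: add_pos_pos)
    then have L2: "L \<ge> 1"
      unfolding L_def using \<tau> mult_mono[of 1 \<tau> 1 "ln (exp 1 + T)"] by simp
    have "B * 1 \<le> B * L" using B L2 by (intro mult_left_mono)
    with L1 have "(real j + 1) / 2 \<le> (1 + B) * L" by (simp add: algebra_simps)
    then have "real j + 1 \<le> ln (exp 1 + T) * (2 * \<tau> * (1 + B))" by (simp add: L_def algebra_simps)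
    moreover have "2 * \<tau> * (1 + B) > 0" using \<tau> B by simp
    ultimately have "(real j + 1) / (2 * \<tau> * (1 + B)) \<le> ln (exp 1 + T)"
      by (simp only: pos_divide_le_eq)
    then show ?thesis by (simp add: T_def c_def)
  qed
  with c show ?thesis by blast
qed

text \<open>Below the height \<open>T\<close> the first summand dominates; above it,
  \<open>t\<^sup>p = t\<^bsup>p-\<tau>\<^esup> t\<^sup>\<tau>\<close> with the decreasing factor \<open>t\<^bsup>p-\<tau>\<^esup>\<close>, and the logarithm of \<open>t\<close> exceeds that of \<open>T\<close>.\<close>
lemma powr_LlogL_split:
  fixes p \<tau> q t T :: real
  assumes "0 \<le> t" "0 < T" "p \<le> \<tau>" "0 \<le> q" "0 < p"
  shows "t powr p \<le> T powr p + T powr (p - \<tau>) * ln (exp 1 + T) powr (- q)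
    * (t powr \<tau> * ln (exp 1 + t) powr q)"
proof (cases "t \<le> T")
  case True
  then have "t powr p \<le> T powr p" using assms by (intro powr_mono2) auto
  then show ?thesis by (smt (verit) mult_nonneg_nonneg powr_ge_zero)
next
  case False
  have ln1: "ln (exp 1 + y) \<ge> 1" if "y \<ge> 0" for y :: real
    using ln_le_cancel_iff[of "exp 1" "exp 1 + y"] that by (simp add: add_pos_nonneg)
  have lnT: "ln (exp 1 + T) \<le> ln (exp 1 + t)"
    using False assms by (subst ln_le_cancel_iff) (auto simp: add_pos_pos)
  have "t powr p = t powr (p - \<tau>) * 1 * t powr \<tau>" by (simp add: powr_add[symmetric])
  also have "\<dots> \<le> T powr (p - \<tau>) * (ln (exp 1 + T) powr (- q) * ln (exp 1 + t) powr q) * t powr \<tau>"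
  proof (intro mult_right_mono mult_mono)
    show "t powr (p - \<tau>) \<le> T powr (p - \<tau>)"
      using False assms by (intro powr_mono2') auto
    have "ln (exp 1 + T) powr q \<le> ln (exp 1 + t) powr q"
      using lnT ln1[of T] assms by (intro powr_mono2) auto
    then show "1 \<le> ln (exp 1 + T) powr (- q) * ln (exp 1 + t) powr q"
      using ln1[of T] assms by (simp add: powr_minus field_simps)
  qed auto
  finally show ?thesis by (smt (verit) mult.assoc mult.commute powr_ge_zero)
qed

text \<open>Integrating the previous splitting over \<open>E = {x. P x}\<close> gives
  \<open>T\<^sup>p N(E) + T\<^bsup>p-\<tau>\<^esup> ln(e + T)\<^bsup>-q\<^esup>\<close>. The height \<open>T = e\<^bsup>j/\<tau>\<^esup> (j + 1)\<^bsup>-q/\<tau>\<^esup>\<close> balances the two terms, given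
  \<open>N(E) \<le> V e\<^bsup>-j\<^esup>\<close> and \<open>ln(e + T) \<ge> c (j + 1)\<close>: both become multiples of \<open>\<rho>\<^sup>p\<close> with
  \<open>\<rho> = e\<^bsup>-j (1/p - 1/\<tau>)\<^esup> (j + 1)\<^bsup>-q/\<tau>\<^esup>\<close>.\<close>
lemma integral_powr_le_on_small_set:
  fixes p \<tau> q c V :: real and j :: nat
  assumes p: "0 < p" "p \<le> \<tau>" and \<tau>: "1 \<le> \<tau>" and q: "0 < q" and c: "0 < c"
    and growth: "c * (real j + 1) \<le> ln (exp 1 + exp (real j / \<tau>) * (real j + 1) powr (- q / \<tau>))"
    and N: "finite_measure N" and [measurable]: "F \<in> borel_measurable N" "Measurable.pred N P"
    and A: "integrable N (\<lambda>x. \<bar>F x\<bar> powr \<tau> * ln (exp 1 + \<bar>F x\<bar>) powr q)"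
      "(LINT x|N. \<bar>F x\<bar> powr \<tau> * ln (exp 1 + \<bar>F x\<bar>) powr q) \<le> 1"
    and small: "measure N {x \<in> space N. P x} \<le> V * exp (- real j)"
  shows "(LINT x|N. (if P x then \<bar>F x\<bar> powr p else 0)) powr (1 / p)
    \<le> (V + c powr (- q)) powr (1 / p)
        * (exp (- real j * (1 / p - 1 / \<tau>)) * (real j + 1) powr (- (q / \<tau>)))"
proof -
  interpret N: finite_measure N by (rule N)
  define b where "b = real j + 1"
  have b: "b > 0" by (simp add: b_def)
  define T where "T = exp (real j / \<tau>) * b powr (- q / \<tau>)"
  have T: "T > 0" using b by (simp add: T_def)
  define \<rho> where "\<rho> = exp (- real j * (1 / p - 1 / \<tau>)) * b powr (- (q / \<tau>))"
  have \<rho>: "\<rho> > 0" using b by (simp add: \<rho>_def)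
  have \<rho>p: "\<rho> powr p = exp (- real j * (1 - p / \<tau>)) * b powr (- (q * p / \<tau>))"
    using p b by (simp add: \<rho>_def powr_mult powr_powr exp_powr_real) (simp add: field_simps)
  have VT: "T powr p * exp (- real j) = \<rho> powr p"
    using b \<tau> by (simp add: \<rho>p T_def powr_mult powr_powr exp_powr_real exp_add[symmetric])
      (simp add: field_simps exp_add[symmetric])
  have tail: "T powr (p - \<tau>) * ln (exp 1 + T) powr (- q) \<le> c powr (- q) * \<rho> powr p"
  proof -
    have "ln (exp 1 + T) powr (- q) \<le> (c * b) powr (- q)"
      using growth q c b by (intro powr_mono2') (auto simp: T_def b_def)
    then have "T powr (p - \<tau>) * ln (exp 1 + T) powr (- q) \<le> T powr (p - \<tau>) * (c * b) powr (- q)"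
      by (intro mult_left_mono) auto
    also have "\<dots> = c powr (- q) * (exp (real j / \<tau> * (p - \<tau>)) * (b powr (- q / \<tau> * (p - \<tau>)) * b powr (- q)))"
      using b c by (simp add: T_def powr_mult powr_powr exp_powr_real)
    also have "b powr (- q / \<tau> * (p - \<tau>)) * b powr (- q) = b powr (- (q * p / \<tau>))"
      using \<tau> by (simp add: powr_add[symmetric]) (simp add: field_simps)
    also have "real j / \<tau> * (p - \<tau>) = - real j * (1 - p / \<tau>)"
      using \<tau> by (simp add: field_simps)
    finally show ?thesis by (simp add: \<rho>p)
  qed
  let ?h = "\<lambda>x. \<bar>F x\<bar> powr \<tau> * ln (exp 1 + \<bar>F x\<bar>) powr q"
  let ?K = "T powr (p - \<tau>) * ln (exp 1 + T) powr (- q)"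
  have K: "?K \<ge> 0" by simp
  have h0: "?h x \<ge> 0" for x by simp
  have int1: "integrable N (\<lambda>x. if P x then 1 else 0 :: real)"
    by (rule N.integrable_const_bound[of _ 1]) auto
  have eq1: "(LINT x|N. (if P x then 1 else 0)) = measure N {x \<in> space N. P x}"
    by (rule integral_of_bool_eq_measure) simp
  have "(LINT x|N. (if P x then \<bar>F x\<bar> powr p else 0))
      \<le> (LINT x|N. T powr p * (if P x then 1 else 0) + ?K * ?h x)"
  proof (rule integral_mono_AE')
    show "integrable N (\<lambda>x. T powr p * (if P x then 1 else 0) + ?K * ?h x)"
      using int1 A(1) by simp
    show "AE x in N. (if P x then \<bar>F x\<bar> powr p else 0) \<le> T powr p * (if P x then 1 else 0) + ?K * ?h x"
      using powr_LlogL_split[of "\<bar>F _\<bar>" T p \<tau> q] T p q K h0 by (intro AE_I2) auto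
  qed auto
  also have "\<dots> = T powr p * measure N {x \<in> space N. P x} + ?K * (LINT x|N. ?h x)"
    using int1 A(1) eq1 by simp
  also have "\<dots> \<le> T powr p * (V * exp (- real j)) + ?K * 1"
    using small A(2) K by (intro add_mono mult_left_mono) auto
  also have "\<dots> \<le> V * \<rho> powr p + c powr (- q) * \<rho> powr p"
    using tail VT by (simp add: ac_simps)
  finally have "(LINT x|N. (if P x then \<bar>F x\<bar> powr p else 0)) \<le> (V + c powr (- q)) * \<rho> powr p"
    by (simp add: algebra_simps)
  then have "(LINT x|N. (if P x then \<bar>F x\<bar> powr p else 0)) powr (1 / p)
      \<le> ((V + c powr (- q)) * \<rho> powr p) powr (1 / p)"
    using p by (intro powr_mono2) auto
  also have "\<dots> = (V + c powr (- q)) powr (1 / p) * \<rho>"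
  proof -
    have "V * exp (- real j) \<ge> 0" using small measure_nonneg[of N] order_trans by blast
    then have "V \<ge> 0" by (simp add: zero_le_mult_iff)
    then show ?thesis using p \<rho> by (simp add: powr_mult powr_powr)
  qed
  finally show ?thesis by (simp add: \<rho>_def b_def)
qed

section \<open>Energy estimates on super-level sets\<close>

lemma borel_measurable_matrix_form:
  fixes Q :: "'a \<Rightarrow> real ^ 'n ^ 'n"
  assumes Q: "Q \<in> borel_measurable M" and w: "w \<in> borel_measurable M" and z: "z \<in> borel_measurable M"
  shows "(\<lambda>x. w x \<bullet> (Q x *v z x)) \<in> borel_measurable M"
proof -
  have [measurable]: "(\<lambda>x. Q x $ i $ j) \<in> borel_measurable M" for i j
    by (rule measurable_compose[OF Q]) (intro borel_measurable_continuous_onI continuous_intros)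
  have [measurable]: "(\<lambda>x. w x $ i) \<in> borel_measurable M" "(\<lambda>x. z x $ i) \<in> borel_measurable M" for i
    by (rule measurable_compose[OF w] measurable_compose[OF z],
        intro borel_measurable_continuous_onI continuous_intros)+
  show ?thesis unfolding inner_vec_def matrix_vector_mult_def by simp
qed

text \<open>With \<open>a = \<surd>Q w\<close> and \<open>b = \<surd>Q g\<close>, the identity \<open>|a|\<^sup>2 = a \<bullet> b + |a - b|\<^sup>2 + b \<bullet> (a - b)\<close> separates
  the term seen by the weak equation from an error that is small when \<open>w\<close> is close to \<open>g\<close> in \<open>L\<^sup>2\<^sub>Q\<close>.
  The error is integrated over all of \<open>\<Omega>\<close>, hence is independent of the set \<open>{x. P x}\<close>.\<close>
lemma L2Q_truncated_energy_le:
  fixes Q :: "real ^ 'n \<Rightarrow> real ^ 'n ^ 'n"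
  assumes Q[measurable]: "Q \<in> borel_measurable (lebesgue_on \<Omega>)"
    and psd: "\<And>x. x \<in> \<Omega> \<Longrightarrow> pos_semidef (Q x)"
    and w: "w \<in> L2Q Q \<Omega>" and g: "g \<in> L2Q Q \<Omega>"
    and [measurable]: "Measurable.pred (lebesgue_on \<Omega>) P"
  shows "(LINT x|lebesgue_on \<Omega>. (if P x then (norm (mat_sqrt (Q x) *v w x))\<^sup>2 else 0))
    \<le> (LINT x|lebesgue_on \<Omega>. (if P x then w x else 0) \<bullet> (Q x *v g x))
      + ((L2Q_norm Q \<Omega> (\<lambda>x. w x - g x))\<^sup>2
        + L2Q_norm Q \<Omega> g * L2Q_norm Q \<Omega> (\<lambda>x. w x - g x))"
proof -
  let ?M = "lebesgue_on \<Omega>"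
  let ?S = "\<lambda>x. mat_sqrt (Q x)"
  let ?d = "\<lambda>x. w x - g x"
  have wm[measurable]: "w \<in> borel_measurable ?M" and gm[measurable]: "g \<in> borel_measurable ?M"
    using w g by (auto simp: L2Q_def)
  have inner: "(?S x *v y) \<bullet> (?S x *v z) = y \<bullet> (Q x *v z)" if "x \<in> \<Omega>" for x y z
    using inner_mat_sqrt[OF psd[OF that]] .
  have meas: "(\<lambda>x. norm (?S x *v h x)) \<in> borel_measurable ?M" if "h \<in> borel_measurable ?M" for h
  proof -
    have "(\<lambda>x. sqrt (h x \<bullet> (Q x *v h x))) \<in> borel_measurable ?M"
      using borel_measurable_matrix_form[OF Q that that] by simp
    moreover have "sqrt (h x \<bullet> (Q x *v h x)) = norm (?S x *v h x)" if "x \<in> space ?M" for x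
      using that inner[of x "h x" "h x"] by (simp add: norm_eq_sqrt_inner)
    ultimately show ?thesis using measurable_cong[of ?M] by (metis (no_types, lifting))
  qed
  have [measurable]: "(\<lambda>x. norm (?S x *v w x)) \<in> borel_measurable ?M"
      "(\<lambda>x. norm (?S x *v g x)) \<in> borel_measurable ?M"
      "(\<lambda>x. norm (?S x *v ?d x)) \<in> borel_measurable ?M"
    using meas by auto
  have intw: "integrable ?M (\<lambda>x. (norm (?S x *v w x))\<^sup>2)"
    and intg: "integrable ?M (\<lambda>x. (norm (?S x *v g x))\<^sup>2)" using w g by (auto simp: L2Q_def)
  have intd: "integrable ?M (\<lambda>x. (norm (?S x *v ?d x))\<^sup>2)"
  proof (rule Bochner_Integration.integrable_bound)
    show "integrable ?M (\<lambda>x. 2 * (norm (?S x *v w x))\<^sup>2 + 2 * (norm (?S x *v g x))\<^sup>2)"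
      using intw intg by simp
    have "(norm (a - b))\<^sup>2 \<le> 2 * (norm a)\<^sup>2 + 2 * (norm b)\<^sup>2" for a b :: "real ^ 'n"
    proof -
      have "(norm (a - b))\<^sup>2 \<le> (norm a + norm b)\<^sup>2"
        by (intro power_mono norm_triangle_ineq4) simp
      also have "\<dots> \<le> 2 * (norm a)\<^sup>2 + 2 * (norm b)\<^sup>2"
        using sum_squares_bound[of "norm a" "norm b"] by (simp add: power2_sum)
      finally show ?thesis .
    qed
    then show "AE x in ?M. norm ((norm (?S x *v ?d x))\<^sup>2)
        \<le> norm (2 * (norm (?S x *v w x))\<^sup>2 + 2 * (norm (?S x *v g x))\<^sup>2)"
      by (simp add: matrix_vector_mult_diff_distrib)
  qed simp
  note CS = integral_Cauchy_Schwarz[of "\<lambda>x. norm (?S x *v g x)" ?M "\<lambda>x. norm (?S x *v ?d x)", OF _ _ intg intd]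
  have intgd: "integrable ?M (\<lambda>x. norm (?S x *v g x) * norm (?S x *v ?d x))" by (rule CS) auto
  have intwg: "integrable ?M (\<lambda>x. norm (?S x *v w x) * norm (?S x *v g x))"
    by (rule integral_Cauchy_Schwarz[OF _ _ intw intg]) auto
  have wPg: "integrable ?M (\<lambda>x. (if P x then w x else 0) \<bullet> (Q x *v g x))"
  proof (rule Bochner_Integration.integrable_bound[OF intwg])
    show "(\<lambda>x. (if P x then w x else 0) \<bullet> (Q x *v g x)) \<in> borel_measurable ?M"
      by (rule borel_measurable_matrix_form[OF Q _ gm]) simp
    have "\<bar>w x \<bullet> (Q x *v g x)\<bar> \<le> norm (?S x *v w x) * norm (?S x *v g x)" if "x \<in> \<Omega>" for x
      using Cauchy_Schwarz_ineq2[of "?S x *v w x" "?S x *v g x"] inner[OF that] by simp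
    then show "AE x in ?M. norm ((if P x then w x else 0) \<bullet> (Q x *v g x))
        \<le> norm (norm (?S x *v w x) * norm (?S x *v g x))"
      by (intro AE_I2) auto
  qed
  have pw: "(if P x then (norm (?S x *v w x))\<^sup>2 else 0) \<le> (if P x then w x else 0) \<bullet> (Q x *v g x)
      + ((norm (?S x *v ?d x))\<^sup>2 + norm (?S x *v g x) * norm (?S x *v ?d x))" if "x \<in> \<Omega>" for x
  proof (cases "P x")
    case True
    let ?a = "?S x *v w x" and ?b = "?S x *v g x"
    have "(norm ?a)\<^sup>2 = ?a \<bullet> ?b + (norm (?a - ?b))\<^sup>2 + ?b \<bullet> (?a - ?b)"
      by (simp add: power2_norm_eq_inner algebra_simps inner_commute)
    also have "\<dots> \<le> ?a \<bullet> ?b + (norm (?a - ?b))\<^sup>2 + norm ?b * norm (?a - ?b)"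
      using norm_cauchy_schwarz[of ?b "?a - ?b"] by simp
    finally show ?thesis using True inner[OF that] by (simp add: matrix_vector_mult_diff_distrib)
  qed simp
  have "(LINT x|?M. (if P x then (norm (?S x *v w x))\<^sup>2 else 0)) \<le> (LINT x|?M. (if P x then w x else 0) \<bullet> (Q x *v g x)
      + ((norm (?S x *v ?d x))\<^sup>2 + norm (?S x *v g x) * norm (?S x *v ?d x)))"
  proof (rule integral_mono)
    show "integrable ?M (\<lambda>x. if P x then (norm (?S x *v w x))\<^sup>2 else 0)"
      by (rule Bochner_Integration.integrable_bound[OF intw]) auto
  qed (use wPg intd intgd pw in auto)
  also have "\<dots> = (LINT x|?M. (if P x then w x else 0) \<bullet> (Q x *v g x))
      + ((LINT x|?M. (norm (?S x *v ?d x))\<^sup>2) + (LINT x|?M. norm (?S x *v g x) * norm (?S x *v ?d x)))"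
    using wPg intd intgd by simp
  also have "\<dots> \<le> (LINT x|?M. (if P x then w x else 0) \<bullet> (Q x *v g x))
      + ((L2Q_norm Q \<Omega> ?d)\<^sup>2 + L2Q_norm Q \<Omega> g * L2Q_norm Q \<Omega> ?d)"
    using CS(2) by (simp add: L2Q_norm_def)
  finally show ?thesis .
qed

lemma le_of_square_le_mult_add:
  fixes a b e :: real
  assumes "a\<^sup>2 \<le> b * a + e\<^sup>2" "0 \<le> b" "0 \<le> e" "0 \<le> a"
  shows "a \<le> b + e"
proof (rule ccontr)
  assume "\<not> a \<le> b + e"
  then have gt: "b + e < a" by simp
  have "(b + e) * a < a * a" using gt assms by (intro mult_strict_right_mono) linarith+
  moreover have "e * e \<le> e * a" using gt assms by (intro mult_left_mono) linarith+
  ultimately show False using assms(1) by (simp add: power2_eq_square algebra_simps)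
qed

text \<open>Here \<open>\<psi> = max 0 (\<phi> - r)\<close> serves as test function. If \<open>a\<close> denotes its norm in \<open>L\<close> with exponent
  \<open>2\<sigma>\<close>, \<open>E\<close> its energy and \<open>F\<close> the \<open>L\<^sup>p\<close>-norm of \<open>f\<close> over \<open>{\<phi> > r}\<close>, then \<open>a\<^sup>2 \<le> C\<^sub>0\<^sup>2 E\<close> by the Sobolev
  inequality and \<open>E \<le> F a + error\<close> by the weak equation, the previous energy estimate and Hoelder's
  inequality. Solving this quadratic inequality for \<open>a\<close> and applying Chebyshev's inequality to \<open>\<psi>\<close>,
  which exceeds \<open>s - r\<close> on \<open>{\<phi> > s}\<close>, gives the claim.\<close>
lemma level_gap_approximant:
  fixes Q :: "real ^ 'n \<Rightarrow> real ^ 'n ^ 'n" and p \<sigma> C\<^sub>0 r s :: real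
  assumes \<Omega>: "open \<Omega>"
    and Q: "Q \<in> borel_measurable (lebesgue_on \<Omega>)" "\<And>x. x \<in> \<Omega> \<Longrightarrow> pos_semidef (Q x)"
    and v[measurable]: "v \<in> borel_measurable (lebesgue_on \<Omega>)"
    and v0: "\<And>x. x \<in> \<Omega> \<Longrightarrow> 0 \<le> v x"
    and N: "finite_measure (wmeasure v \<Omega>)"
    and \<sigma>: "\<sigma> > 1" and p: "p = 2 * \<sigma> / (2 * \<sigma> - 1)"
    and sobolev: "\<And>\<psi>. \<psi> \<in> Lip0 \<Omega> \<Longrightarrow>
      (LINT x|lebesgue_on \<Omega>. \<bar>\<psi> x\<bar> powr (2 * \<sigma>) * v x) powr (1 / (2 * \<sigma>))
        \<le> C\<^sub>0 * sqrt (LINT x|lebesgue_on \<Omega>. (norm (mat_sqrt (Q x) *v gradient \<psi> x))\<^sup>2)"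
    and weak: "\<And>\<psi>. \<psi> \<in> Lip0 \<Omega> \<Longrightarrow> (LINT x|lebesgue_on \<Omega>. gradient \<psi> x \<bullet> (Q x *v g x)) =
        (LINT x|lebesgue_on \<Omega>. f x * \<psi> x * v x)"
    and f[measurable]: "f \<in> borel_measurable (lebesgue_on \<Omega>)"
    and fp: "integrable (wmeasure v \<Omega>) (\<lambda>x. \<bar>f x\<bar> powr p)"
    and g: "g \<in> L2Q Q \<Omega>"
    and \<phi>: "\<phi> \<in> Lip0 \<Omega>" "gradient \<phi> \<in> L2Q Q \<Omega>"
    and rs: "0 \<le> r" "r < s"
  shows "(s - r) * measure (wmeasure v \<Omega>) {x \<in> \<Omega>. s < \<phi> x} powr (1 / (2 * \<sigma>))
    \<le> C\<^sub>0\<^sup>2 * (LINT x|wmeasure v \<Omega>. (if r < \<phi> x then \<bar>f x\<bar> powr p else 0)) powr (1 / p)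
      + \<bar>C\<^sub>0\<bar> * sqrt ((L2Q_norm Q \<Omega> (\<lambda>x. gradient \<phi> x - g x))\<^sup>2
          + L2Q_norm Q \<Omega> g * L2Q_norm Q \<Omega> (\<lambda>x. gradient \<phi> x - g x))"
proof -
  let ?M = "lebesgue_on \<Omega>" and ?N = "wmeasure v \<Omega>"
  interpret N: finite_measure ?N by (rule N)
  have space[simp]: "space ?N = \<Omega>" by (simp add: wmeasure_def)
  have sets[measurable_cong]: "sets ?N = sets ?M" by (simp add: wmeasure_def)
  have LN: "(LINT x|?N. h x) = (LINT x|?M. h x * v x)" if "h \<in> borel_measurable ?M" for h :: "real ^ 'n \<Rightarrow> real"
    unfolding wmeasure_def using v0 that by (subst integral_density) (auto simp: mult.commute)
  have cont: "continuous_on UNIV \<phi>" by (rule Lip0_continuous[OF \<phi>(1)])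
  then have "\<phi> \<in> borel_measurable borel" by (rule borel_measurable_continuous_onI)
  then have [measurable]: "\<phi> \<in> borel_measurable ?M"
    using \<Omega> by (simp add: measurable_restrict_space1 measurable_completion)
  define \<psi> where "\<psi> y = max 0 (\<phi> y - r)" for y
  have [measurable]: "\<psi> \<in> borel_measurable ?M" unfolding \<psi>_def by simp
  have \<psi>0: "\<psi> y \<ge> 0" for y by (simp add: \<psi>_def)
  have \<psi>L: "\<psi> \<in> Lip0 \<Omega>" unfolding \<psi>_def by (rule Lip0_truncation[OF \<phi>(1) rs(1)])
  have grad: "gradient \<psi> x = (if r < \<phi> x then gradient \<phi> x else 0)" for x
    unfolding \<psi>_def by (rule gradient_truncation[OF cont])
  have p1: "p > 1" and conj: "1 / p + 1 / (2 * \<sigma>) = 1" using \<sigma> by (auto simp: p field_simps)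
  define d where "d = L2Q_norm Q \<Omega> (\<lambda>x. gradient \<phi> x - g x)"
  define H where "H = L2Q_norm Q \<Omega> g"
  have dH: "d \<ge> 0" "H \<ge> 0" by (simp_all add: d_def H_def L2Q_norm_def)
  define E where "E = (LINT x|?M. (norm (mat_sqrt (Q x) *v gradient \<psi> x))\<^sup>2)"
  have E0: "E \<ge> 0" by (simp add: E_def)
  define F where "F = (LINT x|?N. (if r < \<phi> x then \<bar>f x\<bar> powr p else 0)) powr (1 / p)"
  define I where "I = (LINT x|?N. \<bar>\<psi> x\<bar> powr (2 * \<sigma>))"
  define a where "a = I powr (1 / (2 * \<sigma>))"
  obtain B where B: "\<And>x. \<bar>\<psi> x\<bar> \<le> B" using Lip0_bounded[OF \<psi>L] by blast
  \<comment> \<open>A non-integrable function would have integral \<open>0\<close>, and the Sobolev inequality would say nothing.\<close>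
  have int\<psi>: "integrable ?N (\<lambda>x. \<bar>\<psi> x\<bar> powr (2 * \<sigma>))"
    using B \<sigma> by (intro N.integrable_const_bound[of _ "B powr (2 * \<sigma>)"]) (auto intro!: powr_mono2)
  have "E \<le> (LINT x|?M. gradient \<psi> x \<bullet> (Q x *v g x)) + (d\<^sup>2 + H * d)"
  proof -
    have "E = (LINT x|?M. (if r < \<phi> x then (norm (mat_sqrt (Q x) *v gradient \<phi> x))\<^sup>2 else 0))"
      unfolding E_def grad by (intro Bochner_Integration.integral_cong) auto
    then show ?thesis
      using L2Q_truncated_energy_le[OF Q \<phi>(2) g, of "\<lambda>x. r < \<phi> x"] by (simp add: grad d_def H_def)
  qed
  also have "(LINT x|?M. gradient \<psi> x \<bullet> (Q x *v g x)) = (LINT x|?N. f x * \<psi> x)"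
    using weak[OF \<psi>L] by (subst LN) auto
  also have "\<dots> \<le> (LINT x|?N. \<bar>(if r < \<phi> x then f x else 0) * \<psi> x\<bar>)"
  proof -
    have "f x * \<psi> x = (if r < \<phi> x then f x else 0) * \<psi> x" for x by (auto simp: \<psi>_def)
    then have "(LINT x|?N. f x * \<psi> x) = (LINT x|?N. (if r < \<phi> x then f x else 0) * \<psi> x)" by presburger
    also have "\<dots> \<le> \<bar>\<dots>\<bar>" by simp
    also have "\<dots> \<le> (LINT x|?N. \<bar>(if r < \<phi> x then f x else 0) * \<psi> x\<bar>)" by (rule integral_abs_bound)
    finally show ?thesis .
  qed
  also have "\<dots> \<le> F * a"
  proof -
    have eq: "\<bar>if r < \<phi> x then f x else 0\<bar> powr p = (if r < \<phi> x then \<bar>f x\<bar> powr p else 0)" for x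
      by simp
    have "integrable ?N (\<lambda>x. if r < \<phi> x then \<bar>f x\<bar> powr p else 0)"
      by (rule Bochner_Integration.integrable_bound[OF fp]) auto
    then show ?thesis
      using integral_mult_le_Holder[OF p1 _ conj, of "\<lambda>x. if r < \<phi> x then f x else 0" ?N \<psi>] int\<psi> \<sigma>
      by (simp add: eq F_def a_def I_def)
  qed
  finally have EF: "E \<le> F * a + (d\<^sup>2 + H * d)" by simp
  have a0: "a \<ge> 0" and F0: "F \<ge> 0" by (simp_all add: a_def F_def)
  have "a \<le> C\<^sub>0 * sqrt E"
    using sobolev[OF \<psi>L] LN[of "\<lambda>x. \<bar>\<psi> x\<bar> powr (2 * \<sigma>)"] by (simp add: a_def I_def E_def)
  then have "a\<^sup>2 \<le> (C\<^sub>0 * sqrt E)\<^sup>2" using a0 by (intro power_mono)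
  also have "\<dots> = C\<^sub>0\<^sup>2 * E" using E0 by (simp add: power_mult_distrib)
  also have "\<dots> \<le> C\<^sub>0\<^sup>2 * (F * a + (d\<^sup>2 + H * d))" by (intro mult_left_mono EF) simp
  also have "\<dots> = C\<^sub>0\<^sup>2 * F * a + (\<bar>C\<^sub>0\<bar> * sqrt (d\<^sup>2 + H * d))\<^sup>2"
    using dH by (simp add: power_mult_distrib algebra_simps)
  finally have le: "a \<le> C\<^sub>0\<^sup>2 * F + \<bar>C\<^sub>0\<bar> * sqrt (d\<^sup>2 + H * d)"
    using le_of_square_le_mult_add[of a "C\<^sub>0\<^sup>2 * F" "\<bar>C\<^sub>0\<bar> * sqrt (d\<^sup>2 + H * d)"] dH F0 a0 by simp
  let ?m = "measure ?N {x \<in> \<Omega>. s < \<phi> x}"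
  have "(s - r) powr (2 * \<sigma>) * ?m \<le> I"
  proof -
    have [measurable]: "{x \<in> \<Omega>. s < \<phi> x} \<in> sets ?N"
      using measurable_sets[of \<phi> ?N borel "{s<..}"] by (simp add: vimage_def Int_def conj_commute)
    have "(s - r) powr (2 * \<sigma>) * ?m = (LINT x|?N. (s - r) powr (2 * \<sigma>) * indicator {x \<in> \<Omega>. s < \<phi> x} x)"
      by (simp add: Int_absorb2)
    also have "\<dots> \<le> I" unfolding I_def
    proof (rule integral_mono)
      show "integrable ?N (\<lambda>x. (s - r) powr (2 * \<sigma>) * indicat_real {x \<in> \<Omega>. s < \<phi> x} x)"
        by (intro integrable_mult_right integrable_real_indicator) (auto simp: N.emeasure_eq_measure)
      show "(s - r) powr (2 * \<sigma>) * indicat_real {x \<in> \<Omega>. s < \<phi> x} x \<le> \<bar>\<psi> x\<bar> powr (2 * \<sigma>)" for x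
        using rs \<sigma> by (auto simp: indicator_def \<psi>_def intro!: powr_mono2)
    qed (rule int\<psi>)
    finally show ?thesis .
  qed
  then have "((s - r) powr (2 * \<sigma>) * ?m) powr (1 / (2 * \<sigma>)) \<le> a"
    unfolding a_def using \<sigma> by (intro powr_mono2) auto
  also have "((s - r) powr (2 * \<sigma>) * ?m) powr (1 / (2 * \<sigma>)) = (s - r) * ?m powr (1 / (2 * \<sigma>))"
    using \<sigma> rs by (simp add: powr_mult powr_powr)
  finally show ?thesis using le by (simp add: F_def d_def H_def)
qed

text \<open>The limit of the preceding lemma along approximants \<open>\<phi>\<^sub>k\<close> that converge to \<open>u\<close> almost everywhere.
  Neither \<open>N{\<phi>\<^sub>k > t}\<close> nor the integral of \<open>|f|\<^sup>p\<close> over \<open>{\<phi>\<^sub>k > r}\<close> need converge to its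
  counterpart for \<open>u\<close>, because \<open>{u = t}\<close> and \<open>{u = r}\<close> may have positive measure. Intersecting the first set with \<open>{u > t}\<close> and uniting the
  second with \<open>{u \<ge> r}\<close> preserves the inequality and makes both sides converge by dominated
  convergence. The strict level \<open>t\<close> on the left is then moved up to \<open>s\<close>.\<close>
lemma level_gap_solution:
  fixes Q :: "real ^ 'n \<Rightarrow> real ^ 'n ^ 'n" and p \<sigma> C\<^sub>0 r s :: real
  assumes \<Omega>: "open \<Omega>"
    and Q: "Q \<in> borel_measurable (lebesgue_on \<Omega>)" "\<And>x. x \<in> \<Omega> \<Longrightarrow> pos_semidef (Q x)"
    and v: "v \<in> borel_measurable (lebesgue_on \<Omega>)" "\<And>x. x \<in> \<Omega> \<Longrightarrow> 0 \<le> v x"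
    and N: "finite_measure (wmeasure v \<Omega>)"
    and \<sigma>: "\<sigma> > 1" and p: "p = 2 * \<sigma> / (2 * \<sigma> - 1)"
    and sobolev: "\<And>\<psi>. \<psi> \<in> Lip0 \<Omega> \<Longrightarrow>
      (LINT x|lebesgue_on \<Omega>. \<bar>\<psi> x\<bar> powr (2 * \<sigma>) * v x) powr (1 / (2 * \<sigma>))
        \<le> C\<^sub>0 * sqrt (LINT x|lebesgue_on \<Omega>. (norm (mat_sqrt (Q x) *v gradient \<psi> x))\<^sup>2)"
    and sol: "weak_solution Q v \<Omega> f (u, g)"
    and f[measurable]: "f \<in> borel_measurable (lebesgue_on \<Omega>)"
    and fp: "integrable (wmeasure v \<Omega>) (\<lambda>x. \<bar>f x\<bar> powr p)"
    and rs: "0 \<le> r" "r < s"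
  shows "(s - r) * measure (wmeasure v \<Omega>) {x \<in> \<Omega>. s \<le> u x} powr (1 / (2 * \<sigma>))
    \<le> C\<^sub>0\<^sup>2 * (LINT x|wmeasure v \<Omega>. (if r \<le> u x then \<bar>f x\<bar> powr p else 0)) powr (1 / p)"
proof -
  let ?M = "lebesgue_on \<Omega>" and ?N = "wmeasure v \<Omega>"
  interpret N: finite_measure ?N by (rule N)
  have space[simp]: "space ?N = \<Omega>" by (simp add: wmeasure_def)
  have sets[measurable_cong]: "sets ?N = sets ?M" by (simp add: wmeasure_def)
  have p0: "p > 0" using \<sigma> by (simp add: p)
  have uL: "u \<in> L2 v \<Omega>" and gL: "g \<in> L2Q Q \<Omega>"
    and weak: "\<And>\<psi>. \<psi> \<in> Lip0 \<Omega> \<Longrightarrow> (LINT x|?M. gradient \<psi> x \<bullet> (Q x *v g x)) = (LINT x|?M. f x * \<psi> x * v x)"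
    using sol by (auto simp: weak_solution_def QH10_def)
  obtain \<phi> where \<phi>: "\<And>k. \<phi> k \<in> Lip0 \<Omega>" "\<And>k. \<phi> k \<in> L2 v \<Omega>" "\<And>k. gradient (\<phi> k) \<in> L2Q Q \<Omega>"
    and lim: "(\<lambda>k. L2_norm v \<Omega> (\<lambda>x. \<phi> k x - u x)) \<longlonglongrightarrow> 0"
    and limQ: "(\<lambda>k. L2Q_norm Q \<Omega> (\<lambda>x. gradient (\<phi> k) x - g x)) \<longlonglongrightarrow> 0"
    using sol unfolding weak_solution_def QH10_def by auto
  have um[measurable]: "u \<in> borel_measurable ?M" and \<phi>m[measurable]: "\<And>k. \<phi> k \<in> borel_measurable ?M"
    using uL \<phi>(2) by (auto simp: L2_def)
  have intd: "integrable ?N (\<lambda>x. (\<phi> k x - u x)\<^sup>2)" for k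
  proof (rule Bochner_Integration.integrable_bound)
    show "integrable ?N (\<lambda>x. 2 * (\<phi> k x)\<^sup>2 + 2 * (u x)\<^sup>2)" using uL \<phi>(2)[of k] by (auto simp: L2_def)
    have "(a - b)\<^sup>2 \<le> 2 * a\<^sup>2 + 2 * b\<^sup>2" for a b :: real
      using zero_le_power2[of "a + b"] by (simp add: power2_eq_square algebra_simps)
    then show "AE x in ?N. norm ((\<phi> k x - u x)\<^sup>2) \<le> norm (2 * (\<phi> k x)\<^sup>2 + 2 * (u x)\<^sup>2)" by simp
  qed simp
  have "(\<lambda>k. (L2_norm v \<Omega> (\<lambda>x. \<phi> k x - u x))\<^sup>2) \<longlonglongrightarrow> 0\<^sup>2" by (intro tendsto_power lim)
  then have "(\<lambda>k. LINT x|?N. norm ((\<phi> k x - u x)\<^sup>2)) \<longlonglongrightarrow> 0" by (simp add: L2_norm_def)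
  from tendsto_L1_AE_subseq[OF intd this] obtain \<kappa> :: "nat \<Rightarrow> nat" where \<kappa>: "strict_mono \<kappa>"
    and ae: "AE x in ?N. (\<lambda>k. (\<phi> (\<kappa> k) x - u x)\<^sup>2) \<longlonglongrightarrow> 0" by blast
  have AE: "AE x in ?N. (\<lambda>k. \<phi> (\<kappa> k) x) \<longlonglongrightarrow> u x"
    using ae
  proof eventually_elim
    case (elim x)
    then have "(\<lambda>k. sqrt ((\<phi> (\<kappa> k) x - u x)\<^sup>2)) \<longlonglongrightarrow> sqrt 0" by (intro tendsto_real_sqrt)
    then have "(\<lambda>k. \<phi> (\<kappa> k) x - u x) \<longlonglongrightarrow> 0" by (simp add: tendsto_rabs_zero_iff)
    then show ?case by (simp add: LIM_zero_iff)
  qed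
  define d where "d k = L2Q_norm Q \<Omega> (\<lambda>x. gradient (\<phi> (\<kappa> k)) x - g x)" for k
  define H where "H = L2Q_norm Q \<Omega> g"
  have d0: "d \<longlonglongrightarrow> 0" using LIMSEQ_subseq_LIMSEQ[OF limQ \<kappa>] by (simp add: d_def[abs_def] comp_def)
  let ?F = "\<lambda>P. (LINT x|?N. (if P x then \<bar>f x\<bar> powr p else 0))"
  let ?m = "\<lambda>P. measure ?N {x \<in> \<Omega>. P x}"
  have int_if: "(LINT x|?N. (if P x then 1 else 0)) = ?m P" if "Measurable.pred ?N P" for P
    using integral_of_bool_eq_measure[OF that] by simp
  have strict: "(t - r) * ?m (\<lambda>x. t < u x) powr (1 / (2 * \<sigma>)) \<le> C\<^sub>0\<^sup>2 * ?F (\<lambda>x. r \<le> u x) powr (1 / p)"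
    if t: "r < t" for t
  proof -
    let ?l = "\<lambda>k. (t - r) * ?m (\<lambda>x. t < u x \<and> t < \<phi> (\<kappa> k) x) powr (1 / (2 * \<sigma>))"
    let ?R = "\<lambda>k. C\<^sub>0\<^sup>2 * ?F (\<lambda>x. r \<le> u x \<or> r < \<phi> (\<kappa> k) x) powr (1 / p) + \<bar>C\<^sub>0\<bar> * sqrt ((d k)\<^sup>2 + H * d k)"
    have le: "?l k \<le> ?R k" for k
    proof -
      have F: "?F (\<lambda>x. r < \<phi> (\<kappa> k) x) \<le> ?F (\<lambda>x. r \<le> u x \<or> r < \<phi> (\<kappa> k) x)"
      proof (rule integral_mono)
        show "integrable ?N (\<lambda>x. if r < \<phi> (\<kappa> k) x then \<bar>f x\<bar> powr p else 0)"
          "integrable ?N (\<lambda>x. if r \<le> u x \<or> r < \<phi> (\<kappa> k) x then \<bar>f x\<bar> powr p else 0)"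
          by (rule Bochner_Integration.integrable_bound[OF fp]; auto)+
      qed auto
      have [measurable]: "{x \<in> \<Omega>. t < \<phi> (\<kappa> k) x} \<in> sets ?N"
        using measurable_sets[of "\<phi> (\<kappa> k)" ?N borel "{t<..}"] by (simp add: vimage_def Int_def conj_commute)
      have "?m (\<lambda>x. t < u x \<and> t < \<phi> (\<kappa> k) x) \<le> ?m (\<lambda>x. t < \<phi> (\<kappa> k) x)"
        by (intro N.finite_measure_mono) auto
      then have "?l k \<le> (t - r) * ?m (\<lambda>x. t < \<phi> (\<kappa> k) x) powr (1 / (2 * \<sigma>))"
        using t \<sigma> by (intro mult_left_mono powr_mono2) auto
      also have "\<dots> \<le> C\<^sub>0\<^sup>2 * ?F (\<lambda>x. r < \<phi> (\<kappa> k) x) powr (1 / p) + \<bar>C\<^sub>0\<bar> * sqrt ((d k)\<^sup>2 + H * d k)"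
        unfolding d_def H_def
        by (rule level_gap_approximant[OF \<Omega> Q v N \<sigma> p sobolev weak f fp gL \<phi>(1,3) rs(1) t])
      also have "\<dots> \<le> ?R k"
        using p0 F by (intro add_right_mono mult_left_mono powr_mono2) auto
      finally show ?thesis .
    qed
    have "(\<lambda>k. ?m (\<lambda>x. t < u x \<and> t < \<phi> (\<kappa> k) x)) \<longlonglongrightarrow> ?m (\<lambda>x. t < u x)"
    proof -
      have "AE x in ?N. eventually (\<lambda>k. (t < u x \<and> t < \<phi> (\<kappa> k) x) = (t < u x)) sequentially"
        using AE
      proof eventually_elim
        case (elim x)
        show ?case
        proof (cases "t < u x")
          case True
          with elim have "eventually (\<lambda>k. t < \<phi> (\<kappa> k) x) sequentially" by (rule order_tendstoD)
          then show ?thesis by eventually_elim simp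
        qed simp
      qed
      from tendsto_integral_if[OF _ _ _ this, of "\<lambda>_. 1"] show ?thesis by (simp add: int_if)
    qed
    then have l: "?l \<longlonglongrightarrow> (t - r) * ?m (\<lambda>x. t < u x) powr (1 / (2 * \<sigma>))"
      using \<sigma> by (intro tendsto_mult tendsto_const tendsto_powr') auto
    have "(\<lambda>k. ?F (\<lambda>x. r \<le> u x \<or> r < \<phi> (\<kappa> k) x)) \<longlonglongrightarrow> ?F (\<lambda>x. r \<le> u x)"
    proof -
      have "AE x in ?N. eventually (\<lambda>k. (r \<le> u x \<or> r < \<phi> (\<kappa> k) x) = (r \<le> u x)) sequentially"
        using AE
      proof eventually_elim
        case (elim x)
        show ?case
        proof (cases "u x < r")
          case True
          with elim have "eventually (\<lambda>k. \<phi> (\<kappa> k) x < r) sequentially" by (rule order_tendstoD)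
          then show ?thesis by eventually_elim (use True in auto)
        qed simp
      qed
      from tendsto_integral_if[OF fp _ _ this] show ?thesis by simp
    qed
    then have "?R \<longlonglongrightarrow> C\<^sub>0\<^sup>2 * ?F (\<lambda>x. r \<le> u x) powr (1 / p) + \<bar>C\<^sub>0\<bar> * sqrt (0\<^sup>2 + H * 0)"
      using p0 d0 by (intro tendsto_intros tendsto_powr') auto
    then have "?R \<longlonglongrightarrow> C\<^sub>0\<^sup>2 * ?F (\<lambda>x. r \<le> u x) powr (1 / p)" by simp
    from LIMSEQ_le[OF l this] le show ?thesis by blast
  qed
  have "((\<lambda>t. (t - r) * ?m (\<lambda>x. s \<le> u x) powr (1 / (2 * \<sigma>)))
      \<longlongrightarrow> (s - r) * ?m (\<lambda>x. s \<le> u x) powr (1 / (2 * \<sigma>))) (at_left s)"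
    by (intro tendsto_intros)
  then show ?thesis
  proof (rule tendsto_upperbound)
    show "eventually (\<lambda>t. (t - r) * ?m (\<lambda>x. s \<le> u x) powr (1 / (2 * \<sigma>))
        \<le> C\<^sub>0\<^sup>2 * ?F (\<lambda>x. r \<le> u x) powr (1 / p)) (at_left s)"
      using eventually_at_left_real[OF rs(2)]
    proof eventually_elim
      case (elim t)
      have [measurable]: "{x \<in> \<Omega>. t < u x} \<in> sets ?N"
        using measurable_sets[of u ?N borel "{t<..}"] by (simp add: vimage_def Int_def conj_commute)
      have "?m (\<lambda>x. s \<le> u x) \<le> ?m (\<lambda>x. t < u x)"
        using elim by (intro N.finite_measure_mono) auto
      then have "(t - r) * ?m (\<lambda>x. s \<le> u x) powr (1 / (2 * \<sigma>)) \<le> (t - r) * ?m (\<lambda>x. t < u x) powr (1 / (2 * \<sigma>))"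
        using elim \<sigma> by (intro mult_left_mono powr_mono2) auto
      also have "\<dots> \<le> C\<^sub>0\<^sup>2 * ?F (\<lambda>x. r \<le> u x) powr (1 / p)" using elim by (intro strict) simp
      finally show ?case .
    qed
  qed simp
qed

section \<open>Boundedness from the decay of super-level sets\<close>

text \<open>De Giorgi's iteration. The gaps \<open>d\<^sub>j\<close> between consecutive levels \<open>r\<^sub>j\<close> are chosen such that
  \<open>\<Phi> (r\<^sub>j) / d\<^sub>j\<close> is at most \<open>(V e\<^bsup>-(j+1)\<^esup>)\<^sup>\<theta>\<close>, which propagates the bound \<open>N{u \<ge> r\<^sub>j} \<le> V e\<^bsup>-j\<^esup>\<close>.
  As \<open>a > 1\<close>, the levels do not exceed the finite sum \<open>R\<close> of all gaps, and \<open>N{u \<ge> R} = 0\<close>.\<close>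
lemma AE_le_by_level_set_decay:
  fixes \<Phi> :: "real \<Rightarrow> real" and \<theta> a V K :: real
  assumes N: "finite_measure N" and [measurable]: "u \<in> borel_measurable N"
    and pos: "0 < \<theta>" "1 < a" "0 < V" "0 < K"
    and V: "measure N (space N) \<le> V"
    and gap: "\<And>r s. 0 \<le> r \<Longrightarrow> r < s \<Longrightarrow>
      (s - r) * measure N {x \<in> space N. s \<le> u x} powr \<theta> \<le> \<Phi> r"
    and decay: "\<And>r j::nat. measure N {x \<in> space N. r \<le> u x} \<le> V * exp (- real j) \<Longrightarrow>
      \<Phi> r \<le> K * (exp (- real j * \<theta>) * (real j + 1) powr (- a))"
  shows "AE x in N. u x \<le> K * (exp \<theta> / V powr \<theta> * (\<Sum>j. (real j + 1) powr (- a)))"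
proof -
  interpret N: finite_measure N by (rule N)
  define d where "d j = K * (exp \<theta> / V powr \<theta>) * (real j + 1) powr (- a)" for j :: nat
  have d: "d j > 0" for j using pos by (simp add: d_def)
  define r where "r j = (\<Sum>i<j. d i)" for j :: nat
  have r0: "r j \<ge> 0" for j unfolding r_def using d by (intro sum_nonneg) (auto intro: less_imp_le)
  have sum: "summable (\<lambda>j. (real j + 1) powr (- a))"
  proof -
    have "summable (\<lambda>j. real (Suc j) powr (- a))"
      using pos by (subst summable_Suc_iff) (simp add: summable_real_powr_iff)
    then show ?thesis by (simp add: add.commute)
  qed
  define R where "R = K * (exp \<theta> / V powr \<theta> * (\<Sum>j. (real j + 1) powr (- a)))"
  have rR: "r j \<le> R" for j
  proof -
    have "r j = K * (exp \<theta> / V powr \<theta>) * (\<Sum>i<j. (real i + 1) powr (- a))"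
      by (simp add: r_def d_def sum_distrib_left)
    also have "\<dots> \<le> K * (exp \<theta> / V powr \<theta>) * (\<Sum>j. (real j + 1) powr (- a))"
      using pos sum by (intro mult_left_mono sum_le_suminf) auto
    finally show ?thesis by (simp add: R_def)
  qed
  let ?m = "\<lambda>s. measure N {x \<in> space N. s \<le> u x}"
  have m: "?m (r j) \<le> V * exp (- real j)" for j
  proof (induction j)
    case 0
    have "?m (r 0) \<le> measure N (space N)" by (rule N.bounded_measure)
    then show ?case using V by simp
  next
    case (Suc j)
    have "d j * ?m (r (Suc j)) powr \<theta> = (r (Suc j) - r j) * ?m (r (Suc j)) powr \<theta>"
      by (simp add: r_def)
    also have "\<dots> \<le> \<Phi> (r j)" using d r0 by (intro gap) (auto simp: r_def)
    also have "\<dots> \<le> K * (exp (- real j * \<theta>) * (real j + 1) powr (- a))" by (rule decay[OF Suc])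
    also have "\<dots> = d j * (V * exp (- real (Suc j))) powr \<theta>"
      using pos by (simp add: d_def powr_mult exp_powr_real exp_add[symmetric] field_simps)
    finally have "?m (r (Suc j)) powr \<theta> \<le> (V * exp (- real (Suc j))) powr \<theta>"
      using d[of j] by (simp only: mult_le_cancel_left_pos)
    then show ?case using pos by (metis less_eq_real_def measure_nonneg mult_nonneg_nonneg
        exp_ge_zero powr_less_mono2 not_le)
  qed
  have "?m R = 0"
  proof (rule antisym)
    have "?m R \<le> V * exp (- real j)" for j
      using rR[of j] by (intro order_trans[OF N.finite_measure_mono m]) auto
    moreover have "(\<lambda>j::nat. V * exp (- real j)) \<longlonglongrightarrow> V * 0"
      by (intro tendsto_mult tendsto_const) real_asymp
    ultimately show "?m R \<le> 0" by (intro LIMSEQ_le_const[of "\<lambda>j::nat. V * exp (- real j)"]) auto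
  qed simp
  then have "AE x in N. \<not> R \<le> u x"
    by (subst AE_iff_measurable[OF _ refl]) (auto simp: N.emeasure_eq_measure)
  then show ?thesis unfolding R_def by eventually_elim simp
qed

theorem theorem2p1:
  fixes \<Omega> :: "(real ^ 'n) set"
    and Q :: "real ^ 'n \<Rightarrow> real ^ 'n ^ 'n"
    and v :: "real ^ 'n \<Rightarrow> real"
    and k C\<^sub>0 \<sigma> \<sigma>' q :: real
    and A :: "real \<Rightarrow> real"
  assumes "bounded \<Omega>" and "open \<Omega>" and "connected \<Omega>"
    and "Q \<in> borel_measurable (lebesgue_on \<Omega>)"
    and "\<And>x. x \<in> \<Omega> \<Longrightarrow> pos_semidef (Q x)"
    and "v \<in> borel_measurable (lebesgue_on \<Omega>)"
    and "\<And>x. x \<in> \<Omega> \<Longrightarrow> 0 \<le> v x"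
    and "integrable (lebesgue_on \<Omega>) v"
    and "AE x in lebesgue_on \<Omega>. onorm (\<lambda>\<xi>. Q x *v \<xi>) \<le> k * v x"
    and "\<sigma> > 1"
    and "\<And>\<psi>. \<psi> \<in> Lip0 \<Omega> \<Longrightarrow>
      (LINT x|lebesgue_on \<Omega>. \<bar>\<psi> x\<bar> powr (2 * \<sigma>) * v x) powr (1 / (2 * \<sigma>))
        \<le> C\<^sub>0 * sqrt (LINT x|lebesgue_on \<Omega>. (norm (mat_sqrt (Q x) *v gradient \<psi> x))\<^sup>2)"
    and "\<sigma>' = \<sigma> / (\<sigma> - 1)"
    and "q > \<sigma>'"
    and "\<And>t. t \<ge> 0 \<Longrightarrow> A t = t powr \<sigma>' * ln (exp 1 + t) powr q"
  shows "\<exists>C::real. C \<ge> 0 \<and>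
    (\<forall>f \<in> orlicz_space A v \<Omega>. \<forall>u g.
      weak_solution Q v \<Omega> f (u, g) \<and> (AE x in wmeasure v \<Omega>. 0 \<le> u x) \<longrightarrow>
      Linf_norm v \<Omega> u \<le> ennreal C * orlicz_norm A v \<Omega> f)"
proof -
  note \<Omega> = assms(2) and Q = assms(4,5) and v = assms(6,7) and vint = assms(8)
    and \<sigma> = assms(10) and sobolev = assms(11) and \<sigma>'_def = assms(12) and q = assms(13) and A = assms(14)
  let ?M = "lebesgue_on \<Omega>" and ?N = "wmeasure v \<Omega>"
  have vm[measurable]: "v \<in> borel_measurable ?M" by (rule v)
  have space[simp]: "space ?N = \<Omega>" by (simp add: wmeasure_def)
  have sets[measurable_cong]: "sets ?N = sets ?M" by (simp add: wmeasure_def)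
  have nnN: "(\<integral>\<^sup>+x. ennreal (h x) \<partial>?N) = (\<integral>\<^sup>+x. ennreal (h x * v x) \<partial>?M)"
    if "h \<in> borel_measurable ?M" for h :: "real ^ 'n \<Rightarrow> real"
    unfolding wmeasure_def using that v
    by (subst nn_integral_density) (auto simp: ennreal_mult''[symmetric] mult.commute intro!: nn_integral_cong)
  have N: "finite_measure ?N"
  proof (rule finite_measureI)
    have "emeasure ?N (space ?N) = (\<integral>\<^sup>+x. ennreal (v x) \<partial>?M)"
      using nnN[of "\<lambda>_. 1"] by simp
    also have "\<dots> = ennreal (LINT x|?M. v x)"
      using v by (intro nn_integral_eq_integral vint AE_I2) simp
    also have "\<dots> \<noteq> \<infinity>" by simp
    finally show "emeasure ?N (space ?N) \<noteq> \<infinity>" .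
  qed
  interpret N: finite_measure ?N by (rule N)
  have \<sigma>': "\<sigma>' > 1" using \<sigma> by (simp add: \<sigma>'_def)
  define p where "p = 2 * \<sigma> / (2 * \<sigma> - 1)"
  have p: "0 < p" "p \<le> \<sigma>'" using \<sigma> by (auto simp: p_def \<sigma>'_def field_simps)
  define \<theta> where "\<theta> = 1 / (2 * \<sigma>)"
  have \<theta>: "\<theta> > 0" "1 / p - 1 / \<sigma>' = \<theta>" using \<sigma> by (auto simp: \<theta>_def p_def \<sigma>'_def field_simps)
  have q0: "q > 0" "q / \<sigma>' > 1" using q \<sigma>' by auto
  obtain c where c: "c > 0" and growth: "\<And>j::nat. c * (real j + 1)
      \<le> ln (exp 1 + exp (real j / \<sigma>') * (real j + 1) powr (- q / \<sigma>'))"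
    using ln_split_height_ge[of \<sigma>' q] \<sigma>' q0 by auto
  \<comment> \<open>The summand \<open>1\<close> keeps \<open>V\<close> positive when \<open>v = 0\<close> almost everywhere; in \<open>D\<close> below it does so when \<open>C\<^sub>0 = 0\<close>.\<close>
  define V where "V = measure ?N \<Omega> + 1"
  have V: "V > 0" unfolding V_def using measure_nonneg[of ?N \<Omega>] by linarith
  define D where "D = (C\<^sub>0\<^sup>2 + 1) * (V + c powr (- q)) powr (1 / p)"
  have "V + c powr (- q) > 0" using V by (intro add_pos_nonneg) auto
  then have D: "D > 0" by (simp add: D_def add_nonneg_pos)
  define C where "C = D * (exp \<theta> / V powr \<theta> * (\<Sum>j. (real j + 1) powr (- (q / \<sigma>'))))"
  \<comment> \<open>The estimate for every admissible \<open>\<mu>\<close> in the Luxemburg norm; the infimum is taken at the end.\<close>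
  have main: "Linf_norm v \<Omega> u \<le> ennreal (C * \<mu>)"
    if sol: "weak_solution Q v \<Omega> f (u, g)" and u0: "AE x in ?N. 0 \<le> u x"
      and f[measurable]: "f \<in> borel_measurable ?M" and \<mu>: "\<mu> > 0"
      and A1: "(\<integral>\<^sup>+x. ennreal (A (\<bar>f x\<bar> / \<mu>) * v x) \<partial>?M) \<le> 1" for f u g \<mu>
  proof -
    define F where "F x = f x / \<mu>" for x
    have Fm[measurable]: "F \<in> borel_measurable ?M" unfolding F_def by simp
    let ?h = "\<lambda>x. \<bar>F x\<bar> powr \<sigma>' * ln (exp 1 + \<bar>F x\<bar>) powr q"
    have "(\<integral>\<^sup>+x. ennreal (?h x) \<partial>?N) = (\<integral>\<^sup>+x. ennreal (A (\<bar>f x\<bar> / \<mu>) * v x) \<partial>?M)"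
      using \<mu> by (subst nnN) (auto simp: A F_def)
    with A1 have nn: "(\<integral>\<^sup>+x. ennreal (?h x) \<partial>?N) \<le> 1" by simp
    have hint: "integrable ?N ?h"
      using order_le_less_trans[OF nn] by (intro integrableI_nonneg) auto
    have h1: "(LINT x|?N. ?h x) \<le> 1"
      using nn by (subst (asm) nn_integral_eq_integral[OF hint]) auto
    have Fp: "integrable ?N (\<lambda>x. \<bar>F x\<bar> powr p)"
    proof (rule Bochner_Integration.integrable_bound)
      show "integrable ?N (\<lambda>x. 1 + ln (exp 1 + 1) powr (- q) * ?h x)" using hint by simp
      show "AE x in ?N. norm (\<bar>F x\<bar> powr p) \<le> norm (1 + ln (exp 1 + 1) powr (- q) * ?h x)"
        using powr_LlogL_split[of "\<bar>F _\<bar>" 1 p \<sigma>' q] p q0 by (intro AE_I2) simp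
    qed simp
    have fF: "\<bar>f x\<bar> powr p = \<mu> powr p * \<bar>F x\<bar> powr p" for x
      using \<mu> by (simp add: F_def powr_mult[symmetric])
    have fp: "integrable ?N (\<lambda>x. \<bar>f x\<bar> powr p)" unfolding fF using Fp by simp
    have um[measurable]: "u \<in> borel_measurable ?M"
      using sol by (auto simp: weak_solution_def QH10_def L2_def)
    let ?I = "\<lambda>r. (LINT x|?N. (if r \<le> u x then \<bar>F x\<bar> powr p else 0))"
    have I0: "?I r \<ge> 0" for r by (intro integral_nonneg_AE) auto
    have "(LINT x|?N. (if r \<le> u x then \<bar>f x\<bar> powr p else 0)) = \<mu> powr p * ?I r" for r
    proof -
      have "(LINT x|?N. (if r \<le> u x then \<bar>f x\<bar> powr p else 0))
          = (LINT x|?N. \<mu> powr p * (if r \<le> u x then \<bar>F x\<bar> powr p else 0))"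
        unfolding fF by (intro Bochner_Integration.integral_cong) auto
      then show ?thesis by simp
    qed
    then have fI: "(LINT x|?N. (if r \<le> u x then \<bar>f x\<bar> powr p else 0)) powr (1 / p) = \<mu> * ?I r powr (1 / p)" for r
      using \<mu> p I0 by (simp add: powr_mult powr_powr)
    have "AE x in ?N. u x \<le> (D * \<mu>) * (exp \<theta> / V powr \<theta> * (\<Sum>j. (real j + 1) powr (- (q / \<sigma>'))))"
    proof (rule AE_le_by_level_set_decay[where \<Phi> = "\<lambda>r. C\<^sub>0\<^sup>2 * (\<mu> * ?I r powr (1 / p))"])
      show "(s - r) * measure ?N {x \<in> space ?N. s \<le> u x} powr \<theta> \<le> C\<^sub>0\<^sup>2 * (\<mu> * ?I r powr (1 / p))"
        if "0 \<le> r" "r < s" for r s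
        using level_gap_solution[OF \<Omega> Q v N \<sigma> p_def sobolev sol f fp that] by (simp add: fI \<theta>_def)
      show "C\<^sub>0\<^sup>2 * (\<mu> * ?I r powr (1 / p)) \<le> D * \<mu> * (exp (- real j * \<theta>) * (real j + 1) powr (- (q / \<sigma>')))"
        if "measure ?N {x \<in> space ?N. r \<le> u x} \<le> V * exp (- real j)" for r j
      proof -
        have "?I r powr (1 / p) \<le> (V + c powr (- q)) powr (1 / p)
            * (exp (- real j * \<theta>) * (real j + 1) powr (- (q / \<sigma>')))"
          using integral_powr_le_on_small_set[OF p less_imp_le[OF \<sigma>'] q0(1) c growth N _ _ hint h1 that]
          by (simp add: \<theta>(2))
        then have "C\<^sub>0\<^sup>2 * (\<mu> * ?I r powr (1 / p)) \<le> (C\<^sub>0\<^sup>2 + 1) * (\<mu> * ((V + c powr (- q)) powr (1 / p)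
            * (exp (- real j * \<theta>) * (real j + 1) powr (- (q / \<sigma>')))))"
          using \<mu> by (intro mult_mono) auto
        then show ?thesis by (simp add: D_def ac_simps)
      qed
    qed (use N V \<theta> q0 D \<mu> in \<open>auto simp: V_def\<close>)
    then have "AE x in ?N. u x \<le> C * \<mu>" by (simp add: C_def ac_simps)
    with u0 have "AE x in ?N. ennreal \<bar>u x\<bar> \<le> ennreal (C * \<mu>)"
      by eventually_elim (simp add: ennreal_leI)
    then show ?thesis unfolding Linf_norm_def by (intro esssup_I) auto
  qed
  \<comment> \<open>A positive constant, by which the estimate can be divided before passing to the infimum.\<close>
  define C' where "C' = max C 1"
  have C': "C' > 0" by (simp add: C'_def)
  show ?thesis
  proof (intro exI[of _ C'] conjI ballI allI impI)
    show "0 \<le> C'" using C' by simp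
    fix f u g assume f: "f \<in> orlicz_space A v \<Omega>"
      and sol: "weak_solution Q v \<Omega> f (u, g) \<and> (AE x in ?N. 0 \<le> u x)"
    have "Linf_norm v \<Omega> u / ennreal C' \<le> orlicz_norm A v \<Omega> f"
      unfolding orlicz_norm_def
    proof (rule INF_greatest)
      fix \<mu> assume "\<mu> \<in> {\<mu>::real. 0 < \<mu> \<and> (\<integral>\<^sup>+x. ennreal (A (\<bar>f x\<bar> / \<mu>) * v x) \<partial>?M) \<le> 1}"
      then have \<mu>: "\<mu> > 0" and A1: "(\<integral>\<^sup>+x. ennreal (A (\<bar>f x\<bar> / \<mu>) * v x) \<partial>?M) \<le> 1" by auto
      have "Linf_norm v \<Omega> u \<le> ennreal (C * \<mu>)"
        using main[OF _ _ _ \<mu> A1] sol f by (auto simp: orlicz_space_def)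
      also have "\<dots> \<le> ennreal (C' * \<mu>)" using \<mu> by (intro ennreal_leI mult_right_mono) (auto simp: C'_def)
      also have "\<dots> = ennreal C' * ennreal \<mu>" using C' by (simp add: ennreal_mult')
      finally have "Linf_norm v \<Omega> u / ennreal C' \<le> ennreal C' * ennreal \<mu> / ennreal C'"
        by (rule divide_right_mono_ennreal)
      then show "Linf_norm v \<Omega> u / ennreal C' \<le> ennreal \<mu>"
        using C' by (simp add: ennreal_mult_divide_eq mult.commute[of "ennreal C'"])
    qed
    then have "Linf_norm v \<Omega> u / ennreal C' * ennreal C' \<le> orlicz_norm A v \<Omega> f * ennreal C'"
      by (rule mult_right_mono) simp
    moreover have "Linf_norm v \<Omega> u / ennreal C' * ennreal C' = Linf_norm v \<Omega> u"
      using C' by (simp add: ennreal_divide_times)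
    ultimately show "Linf_norm v \<Omega> u \<le> ennreal C' * orlicz_norm A v \<Omega> f"
      by (simp add: mult.commute)
  qed
qed

end
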